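(* Let $\theta\in[\tfrac12,1]$. Suppose that the families $(\underline{A}_h^n)_{0\le n\le N}$, $(\underline{E}_h^n)_{0\le n\le N}$, $(\underline{\lambda}_h^n)_{0\le n\le N}$, with $(\underline{A}_h^n,\underline{E}_h^n,\underline{\lambda}_h^n)\in(X_{\mathrm{curl},h}\otimes\mathfrak g)\times(X_{\mathrm{curl},h}\otimes\mathfrak g)\times(X_{\mathrm{grad},h}\otimes\mathfrak g)$, solve the constrained $\theta$-scheme: for all $n\in\{0,\dots,N-1\}$, $$\delta_t^{n+1}\underline{A}_h=-\underline{E}_h^{n+\theta},$$ $$(\delta_t^{n+1}\underline{E}_h,\underline{v}_h)_{\mathrm{curl},\mathfrak g,h}+(G_h^{\mathfrak g}\underline{\lambda}_h^{n+1},\underline{v}_h)_{\mathrm{curl},\mathfrak g,h}+\int_U\langle[P^{\mathfrak g}_{\mathrm{curl},h}\underline{A}_h^{n+\theta},P^{\mathfrak g}_{\mathrm{grad},h}\underline{\lambda}_h^{n+1}],P^{\mathfrak g}_{\mathrm{curl},h}\underline{v}_h\rangle=(\underline{B}_h^{n+\theta},C_h^{\mathfrak g}\underline{v}_h+\star[\underline{A}_h^{n+\frac12},\underline{v}_h]^{\mathrm{div},h})_{\mathrm{div},\mathfrak g,h}\quad\forall\underline{v}_h\in X_{\mathrm{curl},h}\otimes\mathfrak g,$$ $$(\delta_t^{n+1}\underline{E}_h,G_h^{\mathfrak g}\underline{q}_h)_{\mathrm{curl},\mathfrak g,h}+\int_U\langle P^{\mathfrak g}_{\mathrm{curl},h}(\delta_t^{n+1}\underline{E}_h),[P^{\mathfrak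 g}_{\mathrm{curl},h}\underline{A}_h^{n+1-\theta},P^{\mathfrak g}_{\mathrm{grad},h}\underline{q}_h]\rangle=0\quad\forall\underline{q}_h\in X_{\mathrm{grad},h}\otimes\mathfrak g,$$ where $\underline{B}_h^n=C_h^{\mathfrak g}\underline{A}_h^n+\tfrac12\star[\underline{A}_h^n,\underline{A}_h^n]^{\mathrm{div},h}$. Then, for every $\underline{q}_h\in X_{\mathrm{grad},h}\otimes\mathfrak g$, the quantity $$\mathfrak C^n(\underline{q}_h)=(\underline{E}_h^n,G_h^{\mathfrak g}\underline{q}_h)_{\mathrm{curl},\mathfrak g,h}+\int_U\langle P^{\mathfrak g}_{\mathrm{curl},h}\underline{E}_h^n,[P^{\mathfrak g}_{\mathrm{curl},h}\underline{A}_h^n,P^{\mathfrak g}_{\mathrm{grad},h}\underline{q}_h]\rangle$$ is independent of $n$.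
   Context: **Lie algebra.** $\mathfrak g$ is the (finite-dimensional, real) Lie algebra of a compact Lie group, with bracket $[\cdot,\cdot]$ and an inner product $\langle\cdot,\cdot\rangle$ that is Ad-invariant, so that $\langle[a,b],c\rangle=\langle a,[b,c]\rangle$ for all $a,b,c\in\mathfrak g$. $(e_I)_I$ is a basis of $\mathfrak g$; repeated indices are summed. For $\mathfrak g$-valued vector fields $v,w$ and a $\mathfrak g$-valued function $q$ on (a subset of) $\mathbb R^3$: $[v,q]^\alpha=[v^\alpha,q]$; $(\star[v,w])^\alpha=\varepsilon_{\alpha\mu\nu}[v^\mu,w^\nu]$ with $\varepsilon$ the Levi-Civita symbol; $\langle v,w\rangle=\sum_\mu\langle v^\mu,w^\mu\rangle$. **Mesh.** $U\subset\mathbb R^3$ is a connected bounded polyhedral domain, partitioned by a finite conforming polyhedral mesh with sets of elements $\mathcal T_h$ (polyhedra), flat polygonal faces $\mathcal F_h$, straight edges $\mathcal E_h$ and vertices $\mathcal V_h$ (elements and faces are contractible with Lipschitz boundary). $\mathcal F_T,\mathcal E_T$ are the faces and edges of $T$, $\mathcal E_F$ the edges of $F$; $|\cdot|$ is the measure and $h_P$ the diameter of $P$. Each face $F$ has a fixed unit normal $n_F$, each edge $E$ a fixed unit tangent $t_E$. $\omega_{TF}=+1$ if $n_F$ points out of $T$, $-1$ otherwise. For $E\in\mathcal E_F$, $n_{FE}$ is the unit normal to $E$ in the plane of $F$ with $(t_E,n_{FE},n_F)$ right-handed, and $\omega_{FE}\in\{\pm1\}$ is such that $\omega_{FE}n_{FE}$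 points out of $F$. $H_F$ is the vector plane tangent to $F$; $\nabla_F,\mathrm{div}_F$ are the tangential gradient and divergence; $\mathbf{rot}_F r=(\nabla_F r)^\perp$ with $\perp$ the rotation by $-\pi/2$ in $H_F$ oriented by $n_F$. For $P\in\mathcal T_h\cup\mathcal F_h\cup\mathcal E_h$, $\mathcal P^k(P)$ denotes polynomials of degree $\le k$ on $P$, $\mathcal P^{0,1}(P)=\{r\in\mathcal P^1(P):\int_P r=0\}$, and $x_P$ is a fixed point of $P$. For $\xi\in\mathbb R^3$, $\xi_{\mathrm t,F}=n_F\times(\xi\times n_F)$. **Scalar discrete spaces and operators.** $X_{\mathrm{grad},h}$ is the space of continuous functions $q$ on the union of the edges with $q_E:=q|_E\in\mathcal P^1(E)$ for each edge; $X_{\mathrm{curl},h}=\{(v_E)_{E\in\mathcal E_h}:v_E\in\mathbb R\}$; $X_{\mathrm{div},h}=\{(w_F)_{F\in\mathcal F_h}:w_F\in\mathbb R\}$. An index $T$ or $F$ in place of $h$ denotes restriction to the edges/faces of $T$ or $F$. Define $G_h\underline q_h=(q_E')_{E}$ (derivative along $t_E$); $C_h\underline v_h=(C_F\underline v_F)_F$ with $C_F\underline v_F=-\frac1{|F|}\sum_{E\in\mathcal E_F}\omega_{FE}|E|v_E$; $D_T\underline w_T=\frac1{|T|}\sum_{F\in\mathcal F_T}\omega_{TF}|F|w_F$. **Potentials.** - For $\underline q_F$: $\mathsf G_F\underline q_F\in H_F$ with $\mathsf G_F\underline q_F\cdot\xi=\frac1{|F|}\sum_{E\in\mathcal E_F}\omega_{FE}\int_E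 q_E\,\xi\cdot n_{FE}$ for all $\xi\in H_F$; $\gamma_F\underline q_F\in\mathcal P^1(F)$ with $\int_F\gamma_F\underline q_F\,\mathrm{div}_F v=-\int_F\mathsf G_F\underline q_F\cdot v+\sum_{E\in\mathcal E_F}\omega_{FE}\int_E q_E\,v\cdot n_{FE}$ for all $v\in(x-x_F)\mathcal P^1(F)$. - For $\underline q_T$: $\mathsf G_T\underline q_T\in\mathbb R^3$ with $\mathsf G_T\underline q_T\cdot\xi=\frac1{|T|}\sum_{F\in\mathcal F_T}\omega_{TF}\int_F\gamma_F\underline q_F\,\xi\cdot n_F$ for all $\xi\in\mathbb R^3$; $P_{\mathrm{grad},T}\underline q_T\in\mathcal P^1(T)$ with $\int_T P_{\mathrm{grad},T}\underline q_T\,\mathrm{div}\,v=-\int_T\mathsf G_T\underline q_T\cdot v+\sum_{F\in\mathcal F_T}\omega_{TF}\int_F\gamma_F\underline q_F\,v\cdot n_F$ for all $v\in(x-x_T)\mathcal P^1(T)$. - $\gamma_{\mathrm t,F}\underline v_F\in H_F$ with $\gamma_{\mathrm t,F}\underline v_F\cdot\mathbf{rot}_F r=\frac1{|F|}\int_F C_F\underline v_F\,r+\frac1{|F|}\sum_{E\in\mathcal E_F}\omega_{FE}\int_E v_E r$ for all $r\in\mathcal P^{0,1}(F)$. - $\mathsf C_T\underline v_T\in\mathbb R^3$ with $\mathsf C_T\underline v_T\cdot\xi=\frac1{|T|}\sum_{F\in\mathcal F_T}\omega_{TF}|F|\,\gamma_{\mathrm t,F}\underline v_F\cdot(\xi\times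 n_F)$ for all $\xi\in\mathbb R^3$; $P_{\mathrm{curl},T}\underline v_T\in\mathbb R^3$ with $P_{\mathrm{curl},T}\underline v_T\cdot\mathrm{curl}\,w=\frac1{|T|}\int_T\mathsf C_T\underline v_T\cdot w-\frac1{|T|}\sum_{F\in\mathcal F_T}\omega_{TF}\int_F\gamma_{\mathrm t,F}\underline v_F\cdot(w\times n_F)$ for all $w\in(x-x_T)\times\mathbb R^3$. - $P_{\mathrm{div},T}\underline w_T\in\mathbb R^3$ with $P_{\mathrm{div},T}\underline w_T\cdot\nabla r=-\frac1{|T|}\int_T D_T\underline w_T\,r+\frac1{|T|}\sum_{F\in\mathcal F_T}\omega_{TF}\int_F w_F r$ for all $r\in\mathcal P^{0,1}(T)$. **Inner products.** $(\underline\mu_h,\underline\zeta_h)_{\bullet,h}=\sum_{T}\big(\int_T P_{\bullet,T}\underline\mu_T\cdot P_{\bullet,T}\underline\zeta_T+s_{\bullet,T}(\underline\mu_T,\underline\zeta_T)\big)$ for $\bullet\in\{\mathrm{curl},\mathrm{div}\}$, where $s_{\mathrm{curl},T}(\underline v_T,\underline w_T)=\sum_{F\in\mathcal F_T}h_F\int_F((P_{\mathrm{curl},T}\underline v_T)_{\mathrm t,F}-\gamma_{\mathrm t,F}\underline v_F)\cdot((P_{\mathrm{curl},T}\underline w_T)_{\mathrm t,F}-\gamma_{\mathrm t,F}\underline w_F)+\sum_{E\in\mathcal E_T}h_E^2\int_E(P_{\mathrm{curl},T}\underline v_T\cdot t_E-v_E)(P_{\mathrm{curl},T}\underline w_T\cdot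 t_E-w_E)$ and $s_{\mathrm{div},T}(\underline v_T,\underline w_T)=\sum_{F\in\mathcal F_T}h_F\int_F(P_{\mathrm{div},T}\underline v_T\cdot n_F-v_F)(P_{\mathrm{div},T}\underline w_T\cdot n_F-w_F)$. **Lie algebra-valued versions.** $X_{\bullet,h}\otimes\mathfrak g$ is the same space with $\mathfrak g$-valued components. Any scalar linear operator $L$ extends by $L^{\mathfrak g}(v^I\otimes e_I)=(Lv^I)\otimes e_I$. The inner products are $(\underline\mu_h,\underline\zeta_h)_{\bullet,\mathfrak g,h}=(\underline\mu_h^I,\underline\zeta_h^J)_{\bullet,h}\langle e_I,e_J\rangle$, with induced norms $\|\cdot\|_{\bullet,\mathfrak g,h}$. $P^{\mathfrak g}_{\mathrm{grad},h}$ and $P^{\mathfrak g}_{\mathrm{curl},h}$ are the piecewise functions on $U$ equal to $P^{\mathfrak g}_{\mathrm{grad},T}$, $P^{\mathfrak g}_{\mathrm{curl},T}$ on each $T$. The discrete bracket $\star[\cdot,\cdot]^{\mathrm{div},h}:(X_{\mathrm{curl},h}\otimes\mathfrak g)^2\to X_{\mathrm{div},h}\otimes\mathfrak g$ is defined by $(\star[\underline v_h,\underline w_h]^{\mathrm{div},h})_F=\star[\gamma^{\mathfrak g}_{\mathrm t,F}\underline v_F,\gamma^{\mathfrak g}_{\mathrm t,F}\underline w_F]\cdot n_F$ for all $F\in\mathcal F_h$. **Time stepping.** $0=t^0<t^1<\dots<t^N$ is a (not necessarily uniform) partition of the time interval and $\delta t^{n+\frac12}=t^{n+1}-t^n$.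 For a family $(Z^n)_n$: $\delta_t^{n+1}Z=(Z^{n+1}-Z^n)/\delta t^{n+\frac12}$ and, for any $s\in[0,1]$, $Z^{n+s}=sZ^{n+1}+(1-s)Z^n$ (in particular $Z^{n+1-\theta}=(1-\theta)Z^{n+1}+\theta Z^n$ and $Z^{n+\frac12}=\frac12(Z^n+Z^{n+1})$; this applies also to $\underline B_h^{n+\theta}$). *)

theory Defs
  imports "HOL-Analysis.Analysis"
begin

section \<open>Polyhedral meshes\<close>

type_synonym pt3 = "real ^ 3"

definition polyhedral_set :: "int \<Rightarrow> pt3 set \<Rightarrow> bool" where
  "polyhedral_set d S \<longleftrightarrow> aff_dim S = d \<and>
     (\<exists>\<P>. finite \<P> \<and> S = \<Union>\<P> \<and> (\<forall>P\<in>\<P>. polytope P \<and> aff_dim P = d))"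

text \<open>For a closed set \<open>S\<close> lying in a translate of the subspace \<open>H\<close>: near each of its
  relative boundary points \<open>S\<close> is, in \<open>H\<close>, one side of the graph of a Lipschitz function of
  the coordinates orthogonal to \<open>\<nu>\<close>.\<close>

definition lipschitz_boundary :: "pt3 set \<Rightarrow> pt3 set \<Rightarrow> bool" where
  "lipschitz_boundary H S \<longleftrightarrow>
     (\<forall>p\<in>rel_frontier S. \<exists>\<nu>\<in>H. norm \<nu> = 1 \<and>
        (\<exists>\<epsilon>>0. \<exists>L g. L-lipschitz_on UNIV (g :: pt3 \<Rightarrow> real) \<and>
           (\<forall>z\<in>H. norm z < \<epsilon> \<longrightarrow>
              (p + z \<in> S \<longleftrightarrow> z \<bullet> \<nu> \<le> g (z - (z \<bullet> \<nu>) *\<^sub>R \<nu>)))))"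

definition polyhedral_domain :: "pt3 set \<Rightarrow> bool" where
  "polyhedral_domain U \<longleftrightarrow> open U \<and> connected U \<and> bounded U \<and>
     U = interior (closure U) \<and> polyhedral_set 3 (closure U)"

text \<open>Elements, faces and edges are represented by closed sets. The last three fields are the
  fixed unit normal of a face, the fixed unit tangent of an edge, and the fixed point of an
  element, face or edge.\<close>

record mesh =
  region :: "pt3 set"
  elems :: "pt3 set set"
  faces :: "pt3 set set"
  edges :: "pt3 set set"
  verts :: "pt3 set"
  nrm :: "pt3 set \<Rightarrow> pt3"
  tang :: "pt3 set \<Rightarrow> pt3"
  pnt :: "pt3 set \<Rightarrow> pt3"

definition facesT :: "mesh \<Rightarrow> pt3 set \<Rightarrow> pt3 set set" where
  "facesT M T = {F \<in> faces M. F \<subseteq> frontier T}"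

definition edgesT :: "mesh \<Rightarrow> pt3 set \<Rightarrow> pt3 set set" where
  "edgesT M T = {e \<in> edges M. e \<subseteq> frontier T}"

definition edgesF :: "mesh \<Rightarrow> pt3 set \<Rightarrow> pt3 set set" where
  "edgesF M F = {e \<in> edges M. e \<subseteq> rel_frontier F}"

definition tplane :: "mesh \<Rightarrow> pt3 set \<Rightarrow> pt3 set" where
  "tplane M F = {\<xi>. \<xi> \<bullet> nrm M F = 0}"

text \<open>Conformity is the cell complex condition: the open cells of all dimensions are pairwise
  disjoint, and the boundary of every cell is a union of cells of the next lower dimension.\<close>

definition polyhedral_mesh :: "mesh \<Rightarrow> bool" where
  "polyhedral_mesh M \<longleftrightarrow>
     polyhedral_domain (region M) \<and>
     finite (elems M) \<and> finite (faces M) \<and> finite (edges M) \<and> finite (verts M) \<and>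
     closure (region M) = \<Union>(elems M) \<and>
     (\<forall>T\<in>elems M. polyhedral_set 3 T \<and> contractible T \<and> lipschitz_boundary UNIV T) \<and>
     (\<forall>F\<in>faces M. polyhedral_set 2 F \<and> contractible F \<and> lipschitz_boundary (tplane M F) F) \<and>
     (\<forall>e\<in>edges M. \<exists>a\<in>verts M. \<exists>b\<in>verts M. a \<noteq> b \<and> e = closed_segment a b) \<and>
     disjoint_family_on rel_interior
       (elems M \<union> faces M \<union> edges M \<union> (\<lambda>a. {a}) ` verts M) \<and>
     (\<forall>T\<in>elems M. frontier T = \<Union>(facesT M T)) \<and>
     (\<forall>F\<in>faces M. rel_frontier F = \<Union>(edgesF M F)) \<and>
     (\<forall>F\<in>faces M. \<exists>T\<in>elems M. F \<in> facesT M T) \<and>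
     (\<forall>e\<in>edges M. \<exists>F\<in>faces M. e \<in> edgesF M F) \<and>
     (\<forall>a\<in>verts M. \<exists>e\<in>edges M. a \<in> e) \<and>
     (\<forall>F\<in>faces M. norm (nrm M F) = 1 \<and> (\<forall>x\<in>F. \<forall>y\<in>F. (x - y) \<bullet> nrm M F = 0)) \<and>
     (\<forall>e\<in>edges M. norm (tang M e) = 1 \<and> (\<forall>x\<in>e. \<forall>y\<in>e. x - y \<in> span {tang M e})) \<and>
     (\<forall>P\<in>elems M \<union> faces M \<union> edges M. pnt M P \<in> P)"

text \<open>\<open>\<nu>\<close> points out of \<open>S\<close> across the boundary cell \<open>P\<close>.\<close>

definition points_out :: "pt3 set \<Rightarrow> pt3 set \<Rightarrow> pt3 \<Rightarrow> bool" where
  "points_out S P \<nu> \<longleftrightarrow>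
     (\<exists>x\<in>rel_interior P. \<exists>\<epsilon>>0. \<forall>s. 0 < s \<and> s < \<epsilon> \<longrightarrow> x + s *\<^sub>R \<nu> \<notin> S)"

definition omegaTF :: "mesh \<Rightarrow> pt3 set \<Rightarrow> pt3 set \<Rightarrow> real" where
  "omegaTF M T F = (if points_out T F (nrm M F) then 1 else - 1)"

text \<open>The vector \<open>n \<times> t\<close> is the one for which \<open>(t, n \<times> t, n)\<close> is right-handed.\<close>

definition nrmFE :: "mesh \<Rightarrow> pt3 set \<Rightarrow> pt3 set \<Rightarrow> pt3" where
  "nrmFE M F e = cross3 (nrm M F) (tang M e)"

definition omegaFE :: "mesh \<Rightarrow> pt3 set \<Rightarrow> pt3 set \<Rightarrow> real" where
  "omegaFE M F e = (if points_out F e (nrmFE M F e) then 1 else - 1)"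


section \<open>Integrals, differential operators, polynomials\<close>

definition intT :: "pt3 set \<Rightarrow> (pt3 \<Rightarrow> real) \<Rightarrow> real" where
  "intT T f = (LINT x:T|lborel. f x)"

text \<open>The surface integral over a flat face, in Cartesian coordinates \<open>(s, r)\<close> of its plane
  with respect to an orthonormal frame \<open>(u, n \<times> u)\<close>; it does not depend on the choice of \<open>u\<close>.\<close>

definition intF :: "mesh \<Rightarrow> pt3 set \<Rightarrow> (pt3 \<Rightarrow> real) \<Rightarrow> real" where
  "intF M F f =
     (let u = (SOME u. norm u = 1 \<and> u \<bullet> nrm M F = 0);
          \<phi> = (\<lambda>(s, r). pnt M F + s *\<^sub>R u + r *\<^sub>R cross3 (nrm M F) u)
      in LINT z:{z :: real \<times> real. \<phi> z \<in> F}|lborel. f (\<phi> z))"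

definition intE :: "mesh \<Rightarrow> pt3 set \<Rightarrow> (pt3 \<Rightarrow> real) \<Rightarrow> real" where
  "intE M e f =
     (LINT s:{s :: real. pnt M e + s *\<^sub>R tang M e \<in> e}|lborel. f (pnt M e + s *\<^sub>R tang M e))"

definition vol :: "pt3 set \<Rightarrow> real" where
  "vol T = measure lborel T"

definition area :: "mesh \<Rightarrow> pt3 set \<Rightarrow> real" where
  "area M F = intF M F (\<lambda>_. 1)"

definition len :: "mesh \<Rightarrow> pt3 set \<Rightarrow> real" where
  "len M e = intE M e (\<lambda>_. 1)"

definition grad :: "(pt3 \<Rightarrow> real) \<Rightarrow> pt3 \<Rightarrow> pt3" where
  "grad r x = (THE D. GDERIV r x :> D)"

definition divergence :: "(pt3 \<Rightarrow> pt3) \<Rightarrow> pt3 \<Rightarrow> real" where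
  "divergence v x = trace (jacobian v (at x))"

definition curl :: "(pt3 \<Rightarrow> pt3) \<Rightarrow> pt3 \<Rightarrow> pt3" where
  "curl v x = vector [jacobian v (at x) $ 3 $ 2 - jacobian v (at x) $ 2 $ 3,
                      jacobian v (at x) $ 1 $ 3 - jacobian v (at x) $ 3 $ 1,
                      jacobian v (at x) $ 2 $ 1 - jacobian v (at x) $ 1 $ 2]"

definition gradF :: "mesh \<Rightarrow> pt3 set \<Rightarrow> (pt3 \<Rightarrow> real) \<Rightarrow> pt3 \<Rightarrow> pt3" where
  "gradF M F r x = grad r x - (grad r x \<bullet> nrm M F) *\<^sub>R nrm M F"

definition divF :: "mesh \<Rightarrow> pt3 set \<Rightarrow> (pt3 \<Rightarrow> pt3) \<Rightarrow> pt3 \<Rightarrow> real" where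
  "divF M F v x = divergence v x - nrm M F \<bullet> (jacobian v (at x) *v nrm M F)"

text \<open>Rotation by \<open>-\<pi>/2\<close> about the unit normal \<open>n\<close> maps a tangent vector \<open>\<xi>\<close> to \<open>\<xi> \<times> n\<close>.\<close>

definition rotF :: "mesh \<Rightarrow> pt3 set \<Rightarrow> (pt3 \<Rightarrow> real) \<Rightarrow> pt3 \<Rightarrow> pt3" where
  "rotF M F r x = cross3 (gradF M F r x) (nrm M F)"

text \<open>\<open>P1 H\<close>, where \<open>H\<close> is the space of directions of a cell, represents the polynomials of
  degree at most one on that cell: each is identified with its unique extension to the whole
  space that is constant in the directions orthogonal to \<open>H\<close>.\<close>

definition P1 :: "pt3 set \<Rightarrow> (pt3 \<Rightarrow> real) set" where
  "P1 H = {r. \<exists>a. \<exists>b\<in>H. r = (\<lambda>x. a + b \<bullet> x)}"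

definition P01T :: "pt3 set \<Rightarrow> (pt3 \<Rightarrow> real) set" where
  "P01T T = {r \<in> P1 UNIV. intT T r = 0}"

definition P01F :: "mesh \<Rightarrow> pt3 set \<Rightarrow> (pt3 \<Rightarrow> real) set" where
  "P01F M F = {r \<in> P1 (tplane M F). intF M F r = 0}"

definition tproj :: "mesh \<Rightarrow> pt3 set \<Rightarrow> pt3 \<Rightarrow> pt3" where
  "tproj M F \<xi> = cross3 (nrm M F) (cross3 \<xi> (nrm M F))"


section \<open>Discrete spaces and operators\<close>

text \<open>Elements of the discrete spaces are total functions: on points for the grad space, on
  edges for the curl space (\<open>pt3 set \<Rightarrow> real\<close>), on faces for the div space
  (\<open>pt3 set \<Rightarrow> real\<close>). Values off the union of the edges, off \<open>edges M\<close> and off \<open>faces M\<close>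
  carry no meaning and are never used; equality in a discrete space is therefore equality on
  these sets. Restriction to \<open>T\<close> or \<open>F\<close> is left implicit. The following set is the grad space
  for values in an arbitrary normed space.\<close>

definition Xgrad :: "mesh \<Rightarrow> (pt3 \<Rightarrow> 'a :: real_normed_vector) set" where
  "Xgrad M = {q. continuous_on (\<Union>(edges M)) q \<and>
     (\<forall>e\<in>edges M. \<exists>a b. \<forall>x\<in>e. q x = a + ((x - pnt M e) \<bullet> tang M e) *\<^sub>R b)}"

definition Gh :: "mesh \<Rightarrow> (pt3 \<Rightarrow> real) \<Rightarrow> pt3 set \<Rightarrow> real" where
  "Gh M q e = (THE d. \<forall>x\<in>rel_interior e.
     ((\<lambda>s. q (x + s *\<^sub>R tang M e)) has_real_derivative d) (at 0))"

definition CF :: "mesh \<Rightarrow> (pt3 set \<Rightarrow> real) \<Rightarrow> pt3 set \<Rightarrow> real" where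
  "CF M v F = - (1 / area M F) * (\<Sum>e\<in>edgesF M F. omegaFE M F e * len M e * v e)"

definition DT :: "mesh \<Rightarrow> (pt3 set \<Rightarrow> real) \<Rightarrow> pt3 set \<Rightarrow> real" where
  "DT M w T = 1 / vol T * (\<Sum>F\<in>facesT M T. omegaTF M T F * area M F * w F)"

definition GF :: "mesh \<Rightarrow> pt3 set \<Rightarrow> (pt3 \<Rightarrow> real) \<Rightarrow> pt3" where
  "GF M F q = (THE g. g \<in> tplane M F \<and> (\<forall>\<xi>\<in>tplane M F.
     g \<bullet> \<xi> = 1 / area M F *
       (\<Sum>e\<in>edgesF M F. omegaFE M F e * intE M e (\<lambda>x. q x * (\<xi> \<bullet> nrmFE M F e)))))"

definition gammaF :: "mesh \<Rightarrow> pt3 set \<Rightarrow> (pt3 \<Rightarrow> real) \<Rightarrow> pt3 \<Rightarrow> real" where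
  "gammaF M F q = (THE \<gamma>. \<gamma> \<in> P1 (tplane M F) \<and>
     (\<forall>v \<in> {\<lambda>x. p x *\<^sub>R (x - pnt M F) | p. p \<in> P1 (tplane M F)}.
        intF M F (\<lambda>x. \<gamma> x * divF M F v x) =
          - intF M F (\<lambda>x. GF M F q \<bullet> v x) +
          (\<Sum>e\<in>edgesF M F. omegaFE M F e * intE M e (\<lambda>x. q x * (v x \<bullet> nrmFE M F e)))))"

definition GT :: "mesh \<Rightarrow> pt3 set \<Rightarrow> (pt3 \<Rightarrow> real) \<Rightarrow> pt3" where
  "GT M T q = (THE g. \<forall>\<xi>.
     g \<bullet> \<xi> = 1 / vol T *
       (\<Sum>F\<in>facesT M T. omegaTF M T F * intF M F (\<lambda>x. gammaF M F q x * (\<xi> \<bullet> nrm M F))))"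

definition PgradT :: "mesh \<Rightarrow> pt3 set \<Rightarrow> (pt3 \<Rightarrow> real) \<Rightarrow> pt3 \<Rightarrow> real" where
  "PgradT M T q = (THE \<rho>. \<rho> \<in> P1 UNIV \<and>
     (\<forall>v \<in> {\<lambda>x. p x *\<^sub>R (x - pnt M T) | p. p \<in> P1 UNIV}.
        intT T (\<lambda>x. \<rho> x * divergence v x) =
          - intT T (\<lambda>x. GT M T q \<bullet> v x) +
          (\<Sum>F\<in>facesT M T.
             omegaTF M T F * intF M F (\<lambda>x. gammaF M F q x * (v x \<bullet> nrm M F)))))"

definition gammat :: "mesh \<Rightarrow> pt3 set \<Rightarrow> (pt3 set \<Rightarrow> real) \<Rightarrow> pt3" where
  "gammat M F v = (THE g. g \<in> tplane M F \<and> (\<forall>r\<in>P01F M F. \<forall>x\<in>F.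
     g \<bullet> rotF M F r x =
       1 / area M F * intF M F (\<lambda>y. CF M v F * r y) +
       1 / area M F * (\<Sum>e\<in>edgesF M F. omegaFE M F e * intE M e (\<lambda>y. v e * r y))))"

definition CT :: "mesh \<Rightarrow> pt3 set \<Rightarrow> (pt3 set \<Rightarrow> real) \<Rightarrow> pt3" where
  "CT M T v = (THE c. \<forall>\<xi>.
     c \<bullet> \<xi> = 1 / vol T *
       (\<Sum>F\<in>facesT M T. omegaTF M T F * area M F * (gammat M F v \<bullet> cross3 \<xi> (nrm M F))))"

definition PcurlT :: "mesh \<Rightarrow> pt3 set \<Rightarrow> (pt3 set \<Rightarrow> real) \<Rightarrow> pt3" where
  "PcurlT M T v = (THE p. \<forall>w \<in> {\<lambda>x. cross3 (x - pnt M T) c | c. True}. \<forall>x\<in>T.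
     p \<bullet> curl w x =
       1 / vol T * intT T (\<lambda>y. CT M T v \<bullet> w y) -
       1 / vol T * (\<Sum>F\<in>facesT M T.
          omegaTF M T F * intF M F (\<lambda>y. gammat M F v \<bullet> cross3 (w y) (nrm M F))))"

definition PdivT :: "mesh \<Rightarrow> pt3 set \<Rightarrow> (pt3 set \<Rightarrow> real) \<Rightarrow> pt3" where
  "PdivT M T w = (THE p. \<forall>r\<in>P01T T. \<forall>x\<in>T.
     p \<bullet> grad r x =
       - (1 / vol T) * intT T (\<lambda>y. DT M w T * r y) +
       1 / vol T * (\<Sum>F\<in>facesT M T. omegaTF M T F * intF M F (\<lambda>y. w F * r y)))"


section \<open>Discrete inner products\<close>

definition s_curl ::
  "mesh \<Rightarrow> pt3 set \<Rightarrow> (pt3 set \<Rightarrow> real) \<Rightarrow> (pt3 set \<Rightarrow> real) \<Rightarrow> real" where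
  "s_curl M T v w =
     (\<Sum>F\<in>facesT M T. diameter F * intF M F (\<lambda>x.
        (tproj M F (PcurlT M T v) - gammat M F v) \<bullet> (tproj M F (PcurlT M T w) - gammat M F w))) +
     (\<Sum>e\<in>edgesT M T. (diameter e)\<^sup>2 * intE M e (\<lambda>x.
        (PcurlT M T v \<bullet> tang M e - v e) * (PcurlT M T w \<bullet> tang M e - w e)))"

definition s_div ::
  "mesh \<Rightarrow> pt3 set \<Rightarrow> (pt3 set \<Rightarrow> real) \<Rightarrow> (pt3 set \<Rightarrow> real) \<Rightarrow> real" where
  "s_div M T v w =
     (\<Sum>F\<in>facesT M T. diameter F * intF M F (\<lambda>x.
        (PdivT M T v \<bullet> nrm M F - v F) * (PdivT M T w \<bullet> nrm M F - w F)))"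

definition ip_curl :: "mesh \<Rightarrow> (pt3 set \<Rightarrow> real) \<Rightarrow> (pt3 set \<Rightarrow> real) \<Rightarrow> real" where
  "ip_curl M v w =
     (\<Sum>T\<in>elems M. intT T (\<lambda>x. PcurlT M T v \<bullet> PcurlT M T w) + s_curl M T v w)"

definition ip_div :: "mesh \<Rightarrow> (pt3 set \<Rightarrow> real) \<Rightarrow> (pt3 set \<Rightarrow> real) \<Rightarrow> real" where
  "ip_div M v w =
     (\<Sum>T\<in>elems M. intT T (\<lambda>x. PdivT M T v \<bullet> PdivT M T w) + s_div M T v w)"


section \<open>Lie algebra-valued versions\<close>

text \<open>The inner product of the type is the invariant inner product of the Lie algebra. A
  finite-dimensional real Lie algebra carrying a positive definite invariant inner product is
  the Lie algebra of a compact Lie group, and conversely.\<close>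

definition invariant_lie_algebra :: "('g :: real_inner \<Rightarrow> 'g \<Rightarrow> 'g) \<Rightarrow> bool" where
  "invariant_lie_algebra br \<longleftrightarrow>
     bilinear br \<and>
     (\<forall>a. br a a = 0) \<and>
     (\<forall>a b c. br a (br b c) + br b (br c a) + br c (br a b) = 0) \<and>
     (\<forall>a b c. br a b \<bullet> c = a \<bullet> br b c)"

definition vbr :: "('g \<Rightarrow> 'g \<Rightarrow> 'g) \<Rightarrow> 'g ^ 3 \<Rightarrow> 'g \<Rightarrow> 'g ^ 3" where
  "vbr br v q = (\<chi> \<alpha>. br (v $ \<alpha>) q)"

definition levi_civita :: "3 \<Rightarrow> 3 \<Rightarrow> 3 \<Rightarrow> real" where
  "levi_civita \<alpha> \<mu> \<nu> =
     (if (\<alpha>, \<mu>, \<nu>) \<in> {(1, 2, 3), (2, 3, 1), (3, 1, 2)} then 1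
      else if (\<alpha>, \<mu>, \<nu>) \<in> {(1, 3, 2), (3, 2, 1), (2, 1, 3)} then - 1
      else 0)"

definition star_br :: "('g :: real_vector \<Rightarrow> 'g \<Rightarrow> 'g) \<Rightarrow> 'g ^ 3 \<Rightarrow> 'g ^ 3 \<Rightarrow> 'g ^ 3" where
  "star_br br v w = (\<chi> \<alpha>. \<Sum>\<mu>\<in>UNIV. \<Sum>\<nu>\<in>UNIV. levi_civita \<alpha> \<mu> \<nu> *\<^sub>R br (v $ \<mu>) (w $ \<nu>))"

text \<open>\<open>coef Bs v b\<close> is the scalar family of coordinates of \<open>v\<close> along the vector \<open>b\<close> of the
  basis \<open>Bs\<close>. The operators \<open>lift\<close> and \<open>lift3\<close> extend linear operators on scalar families
  to Lie algebra-valued ones; the target of the scalar operator is a space of real-valued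
  families for \<open>lift\<close>, and \<open>real ^ 3\<close> for \<open>lift3\<close>.\<close>

definition coef :: "'g :: real_vector set \<Rightarrow> ('p \<Rightarrow> 'g) \<Rightarrow> 'g \<Rightarrow> 'p \<Rightarrow> real" where
  "coef Bs v b = (\<lambda>p. representation Bs (v p) b)"

definition lift ::
  "'g :: real_vector set \<Rightarrow> (('p \<Rightarrow> real) \<Rightarrow> 'r \<Rightarrow> real) \<Rightarrow> ('p \<Rightarrow> 'g) \<Rightarrow> 'r \<Rightarrow> 'g" where
  "lift Bs L v = (\<lambda>x. \<Sum>b\<in>Bs. L (coef Bs v b) x *\<^sub>R b)"

definition lift3 ::
  "'g :: real_vector set \<Rightarrow> (('p \<Rightarrow> real) \<Rightarrow> real ^ 3) \<Rightarrow> ('p \<Rightarrow> 'g) \<Rightarrow> 'g ^ 3" where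
  "lift3 Bs L v = (\<chi> \<mu>. \<Sum>b\<in>Bs. (L (coef Bs v b) $ \<mu>) *\<^sub>R b)"

definition ip_g ::
  "'g :: real_inner set \<Rightarrow> (('p \<Rightarrow> real) \<Rightarrow> ('p \<Rightarrow> real) \<Rightarrow> real) \<Rightarrow>
   ('p \<Rightarrow> 'g) \<Rightarrow> ('p \<Rightarrow> 'g) \<Rightarrow> real" where
  "ip_g Bs ip \<mu> \<zeta> = (\<Sum>b\<in>Bs. \<Sum>c\<in>Bs. ip (coef Bs \<mu> b) (coef Bs \<zeta> c) * (b \<bullet> c))"

text \<open>The piecewise functions are set to \<open>0\<close> on the element boundaries, a null set.\<close>

definition Pcurlh ::
  "mesh \<Rightarrow> 'g :: real_vector set \<Rightarrow> (pt3 set \<Rightarrow> 'g) \<Rightarrow> pt3 \<Rightarrow> 'g ^ 3" where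
  "Pcurlh M Bs v x = (\<Sum>T | T \<in> elems M \<and> x \<in> interior T. lift3 Bs (PcurlT M T) v)"

definition Pgradh ::
  "mesh \<Rightarrow> 'g :: real_vector set \<Rightarrow> (pt3 \<Rightarrow> 'g) \<Rightarrow> pt3 \<Rightarrow> 'g" where
  "Pgradh M Bs q x = (\<Sum>T | T \<in> elems M \<and> x \<in> interior T. lift Bs (PgradT M T) q x)"

definition bracket_div ::
  "mesh \<Rightarrow> 'g :: real_vector set \<Rightarrow> ('g \<Rightarrow> 'g \<Rightarrow> 'g) \<Rightarrow>
   (pt3 set \<Rightarrow> 'g) \<Rightarrow> (pt3 set \<Rightarrow> 'g) \<Rightarrow> pt3 set \<Rightarrow> 'g" where
  "bracket_div M Bs br v w F =
     (\<Sum>\<alpha>\<in>UNIV. (nrm M F $ \<alpha>) *\<^sub>R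
        (star_br br (lift3 Bs (gammat M F) v) (lift3 Bs (gammat M F) w) $ \<alpha>))"

definition magnetic ::
  "mesh \<Rightarrow> 'g :: real_vector set \<Rightarrow> ('g \<Rightarrow> 'g \<Rightarrow> 'g) \<Rightarrow> (pt3 set \<Rightarrow> 'g) \<Rightarrow> pt3 set \<Rightarrow> 'g" where
  "magnetic M Bs br A F = lift Bs (CF M) A F + (1 / 2) *\<^sub>R bracket_div M Bs br A A F"


section \<open>Time stepping\<close>

definition delta_t :: "(nat \<Rightarrow> real) \<Rightarrow> (nat \<Rightarrow> 'p \<Rightarrow> 'g :: real_vector) \<Rightarrow> nat \<Rightarrow> 'p \<Rightarrow> 'g" where
  "delta_t t Z n = (\<lambda>p. (Z (Suc n) p - Z n p) /\<^sub>R (t (Suc n) - t n))"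

text \<open>\<open>interp s Z n\<close> is the value of the family \<open>Z\<close> at the index \<open>n + s\<close>, for \<open>0 \<le> s \<le> 1\<close>.\<close>

definition interp :: "real \<Rightarrow> (nat \<Rightarrow> 'p \<Rightarrow> 'g :: real_vector) \<Rightarrow> nat \<Rightarrow> 'p \<Rightarrow> 'g" where
  "interp s Z n = (\<lambda>p. s *\<^sub>R Z (Suc n) p + (1 - s) *\<^sub>R Z n p)"

definition constraint ::
  "mesh \<Rightarrow> 'g :: real_inner set \<Rightarrow> ('g \<Rightarrow> 'g \<Rightarrow> 'g) \<Rightarrow>
   (pt3 set \<Rightarrow> 'g) \<Rightarrow> (pt3 set \<Rightarrow> 'g) \<Rightarrow> (pt3 \<Rightarrow> 'g) \<Rightarrow> real" where
  "constraint M Bs br A E q =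
     ip_g Bs (ip_curl M) E (lift Bs (Gh M) q) +
     (LINT x:region M|lborel.
        Pcurlh M Bs E x \<bullet> vbr br (Pcurlh M Bs A x) (Pgradh M Bs q x))"

end

theory Submission
  imports Defs
begin

text \<open>
  Write \<open>\<tau> v w\<close> for the integrand \<open>\<langle>P v, [P w, P q]\<rangle>\<close>, where \<open>P\<close> are the potentials on the
  elements, and let \<open>d\<close> be the length of the time step from \<open>n\<close> to \<open>n + 1\<close>. Since \<open>\<tau>\<close> is bilinear,
  a discrete product rule splits its increment exactly:
    \<open>\<tau> E\<^sup>n\<^sup>+\<^sup>1 A\<^sup>n\<^sup>+\<^sup>1 - \<tau> E\<^sup>n A\<^sup>n
      = \<tau> (E\<^sup>n\<^sup>+\<^sup>1 - E\<^sup>n) ((1 - \<theta>) A\<^sup>n\<^sup>+\<^sup>1 + \<theta> A\<^sup>n) + \<tau> (\<theta> E\<^sup>n\<^sup>+\<^sup>1 + (1 - \<theta>) E\<^sup>n) (A\<^sup>n\<^sup>+\<^sup>1 - A\<^sup>n)\<close>.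
  The first equation of the scheme makes the last term equal to \<open>- d \<tau> w w\<close> with
  \<open>w = \<theta> E\<^sup>n\<^sup>+\<^sup>1 + (1 - \<theta>) E\<^sup>n\<close>, and \<open>\<tau> w w\<close> vanishes because
  \<open>\<langle>a, [a, c]\<rangle> = \<langle>[a, a], c\<rangle> = 0\<close> (\<open>vbr_self\<close>). What remains, together with the increment of the
  linear part of the constraint, is \<open>d\<close> times the left-hand side of the third equation of the
  scheme, hence zero.

  This computation presupposes two facts about the potentials, each of which is defined as the
  unique solution of a variational problem, so that nothing is known about it before existence and
  uniqueness are established.

  First, the curl potential and, in its first argument, the inner product of the curl space must be
  linear in the edge values, and must depend on nothing else, because the first equation holds only on the edges of
  the mesh. Both requirements are combined in the predicate \<open>edge_linear\<close>. It passes from the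
  right-hand side of a variational problem to the solution
  (\<open>edge_linear_represented\<close>), which yields \<open>edge_linear_gammat\<close>, \<open>edge_linear_CT\<close>,
  \<open>edge_linear_PcurlT\<close> and \<open>edge_linear_ip_curl\<close>.

  Second, the integral of \<open>\<tau>\<close> is additive only if \<open>\<tau>\<close> is integrable, for which the potentials of
  the scalar components of \<open>q\<close> have to be affine on each element. The test functions of their
  definition are radial fields \<open>(a + b \<bullet> (x - p)) (x - p)\<close>, whose divergence
  is \<open>k a + (k + 1) (b \<bullet> (x - p))\<close> in dimension \<open>k\<close>. The variational problem is therefore a linear
  system for the Gram matrix of the affine polynomials, up to an invertible change of the test
  polynomial, and this matrix is invertible on every cell with nonempty relative interior
  (\<open>ex1_affine\<close>, \<open>gammaF_affine\<close>, \<open>PgradT_affine\<close>).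
\<close>

section \<open>Linear maps and the vectors representing them\<close>

text \<open>
  For \<open>\<beta>\<close> the inner product this is the Riesz representation on a subspace; for \<open>\<beta>\<close> an integrated
  product of polynomials it is the solvability of the corresponding Gram system. Definiteness makes
  the map from \<open>x\<close> to the functional \<open>\<beta> x\<close> injective, hence onto by counting dimensions.
\<close>

lemma ex1_representing_vector:
  fixes S :: "'a::euclidean_space set" and L :: "'a \<Rightarrow> real"
  assumes S: "subspace S" and \<beta>: "bilinear \<beta>" and pos: "\<And>x. x \<in> S \<Longrightarrow> \<beta> x x = 0 \<Longrightarrow> x = 0"
    and L: "linear L"
  shows "\<exists>!x. x \<in> S \<and> (\<forall>y\<in>S. \<beta> x y = L y)"
proof -
  obtain B where B: "B \<subseteq> S" "pairwise orthogonal B" "\<And>x. x \<in> B \<Longrightarrow> norm x = 1"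
      "independent B" "card B = dim S" "span B = S"
    using orthonormal_basis_subspace[OF S] by metis
  have fin: "finite B" using B(4) by (simp add: independent_imp_finite)
  \<comment> \<open>\<open>f K\<close> is the Riesz vector of the functional \<open>K\<close> restricted to \<open>S\<close>.\<close>
  define f where "f K = (\<Sum>b\<in>B. K b *\<^sub>R b)" for K :: "'a \<Rightarrow> real"
  have f_in: "f K \<in> S" for K
    unfolding f_def using S B(1) by (intro subspace_sum subspace_scale) auto
  have f_eq: "f K = f K' \<longleftrightarrow> (\<forall>y\<in>S. K y = K' y)" if "linear K" "linear K'" for K K'
  proof
    assume eq: "f K = f K'"
    have "f K \<bullet> c = K c" if "c \<in> B" for K c
    proof -
      have "f K \<bullet> c = (\<Sum>b\<in>B. if b = c then K c else 0)"
        unfolding f_def inner_sum_left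
        using B(2,3) that by (intro sum.cong) (auto simp: pairwise_def orthogonal_def norm_eq_1)
      then show ?thesis using fin that by simp
    qed
    then have "\<forall>b\<in>B. K b = K' b" using eq by metis
    then show "\<forall>y\<in>S. K y = K' y"
      using linear_eq_on_span[OF that] B(6) by blast
  next
    assume "\<forall>y\<in>S. K y = K' y"
    then show "f K = f K'" unfolding f_def using B(1) by (intro sum.cong) auto
  qed
  have lin\<beta>: "linear (\<beta> x)" "linear (\<lambda>x. \<beta> x y)" for x y
    using \<beta> by (auto simp: bilinear_def)
  have lin: "linear (\<lambda>x. f (\<beta> x))"
    unfolding f_def
    by (rule linearI)
       (simp_all add: linear_add[OF lin\<beta>(2)] linear_scale[OF lin\<beta>(2)] scaleR_left_distrib
          sum.distrib scaleR_sum_right)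
  have inj: "inj_on (\<lambda>x. f (\<beta> x)) S"
  proof (rule inj_onI)
    fix x y assume x: "x \<in> S" and y: "y \<in> S" and "f (\<beta> x) = f (\<beta> y)"
    then have "\<beta> x (x - y) = \<beta> y (x - y)"
      using f_eq lin\<beta> S subspace_diff by blast
    then have "\<beta> (x - y) (x - y) = 0" by (simp add: linear_diff[OF lin\<beta>(2)])
    then show "x = y" using pos[of "x - y"] x y S subspace_diff by auto
  qed
  have "(\<lambda>x. f (\<beta> x)) ` S = S"
  proof (rule subspace_dim_equal)
    show "subspace ((\<lambda>x. f (\<beta> x)) ` S)" using lin S by (rule linear_subspace_image)
    show "dim S \<le> dim ((\<lambda>x. f (\<beta> x)) ` S)"
      using dim_image_eq[OF lin] inj S by (simp add: span_eq_iff[THEN iffD2])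
  qed (use S f_in in auto)
  then obtain x where "x \<in> S" and "f (\<beta> x) = f L" using f_in[of L] by (metis imageE)
  show ?thesis
  proof (rule ex1I[of _ x])
    show "x \<in> S \<and> (\<forall>y\<in>S. \<beta> x y = L y)"
      using \<open>x \<in> S\<close> \<open>f (\<beta> x) = f L\<close> f_eq[OF lin\<beta>(1) L] by blast
    fix z assume z: "z \<in> S \<and> (\<forall>y\<in>S. \<beta> z y = L y)"
    then have "f (\<beta> z) = f L" using f_eq[OF lin\<beta>(1) L] by blast
    then have "f (\<beta> z) = f (\<beta> x)" using \<open>f (\<beta> x) = f L\<close> by simp
    then show "z = x" using inj_onD[OF inj] z \<open>x \<in> S\<close> by blast
  qed
qed

lemma linear_mult:
  "linear f \<Longrightarrow> linear (\<lambda>x. c * f x)" "linear f \<Longrightarrow> linear (\<lambda>x. f x * c)" for c :: real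
  by (auto simp: linear_iff algebra_simps)

lemma linear_inner:
  "linear f \<Longrightarrow> linear (\<lambda>x. c \<bullet> f x)" "linear f \<Longrightarrow> linear (\<lambda>x. f x \<bullet> c)"
  by (auto simp: linear_iff inner_add_left inner_add_right)

lemma linear_finite_sum: "(\<And>i. i \<in> J \<Longrightarrow> linear (f i)) \<Longrightarrow> linear (\<lambda>x. \<Sum>i\<in>J. f i x)"
  by (simp add: linear_compose_sum)

lemma linear_cross3:
  "linear f \<Longrightarrow> linear (\<lambda>x. cross3 c (f x))" "linear f \<Longrightarrow> linear (\<lambda>x. cross3 (f x) c)"
  by (auto simp: linear_iff cross_add_left cross_add_right cross_mult_left cross_mult_right)

lemmas linear_intros = linear_mult linear_inner linear_finite_sum linear_cross3
  linear_compose_add linear_compose_sub linear_compose_neg linear_compose_scale_right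

section \<open>Integrals over flat cells\<close>

lemma P1_continuous: "r \<in> P1 H \<Longrightarrow> continuous_on A r"
  by (auto simp: P1_def intro!: continuous_intros)

text \<open>
  The properties shared by the integrals over elements, faces and edges, so that the variational
  problems on cells of all dimensions can be treated alike.
\<close>

locale cell_integral =
  fixes S :: "pt3 set" and I :: "(pt3 \<Rightarrow> real) \<Rightarrow> real"
  assumes add: "continuous_on S f \<Longrightarrow> continuous_on S g \<Longrightarrow> I (\<lambda>x. f x + g x) = I f + I g"
    and scale: "I (\<lambda>x. c * f x) = c * I f"
    and cong: "(\<And>x. x \<in> S \<Longrightarrow> f x = g x) \<Longrightarrow> I f = I g"
begin

lemma const: "I (\<lambda>x. c) = c * I (\<lambda>x. 1)"
  using scale[of c "\<lambda>x. 1"] by simp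

lemma linear_integral:
  fixes f :: "'a::real_vector \<Rightarrow> pt3 \<Rightarrow> real"
  assumes "\<And>x. x \<in> S \<Longrightarrow> linear (\<lambda>y. f y x)" and "\<And>y. continuous_on S (f y)"
  shows "linear (\<lambda>y. I (f y))"
proof (rule linearI)
  fix y z
  have "I (f (y + z)) = I (\<lambda>x. f y x + f z x)"
    by (rule cong) (simp add: linear_add[OF assms(1)])
  then show "I (f (y + z)) = I (f y) + I (f z)" by (simp add: add assms(2))
next
  fix c y
  have "I (f (c *\<^sub>R y)) = I (\<lambda>x. c * f y x)"
    by (rule cong) (simp add: linear_scale[OF assms(1)])
  then show "I (f (c *\<^sub>R y)) = c *\<^sub>R I (f y)" by (simp add: scale)
qed

end

text \<open>
  \<open>H\<close> is the space of directions of the cell. Definiteness of the integral on squares of affine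
  polynomials says that the cell has interior points relative to its plane; it is all that
  the solvability of the variational problems requires of the shape of the cell.
\<close>

locale flat_cell = cell_integral S I for S I +
  fixes H :: "pt3 set" and p :: pt3
  assumes nonempty: "S \<noteq> {}" and H: "subspace H"
    and definite: "b \<in> H \<Longrightarrow> I (\<lambda>x. (a + b \<bullet> (x - p))\<^sup>2) = 0 \<Longrightarrow> a = 0 \<and> b = 0"
begin

lemma measure_nonzero: "I (\<lambda>x. 1) \<noteq> 0"
  using definite[of 0 1] H by (auto simp: subspace_0)

lemma P1_eq: "P1 H = {(\<lambda>x. a + b \<bullet> (x - p)) | a b. b \<in> H}"
proof (intro equalityI subsetI)
  fix r assume "r \<in> P1 H"
  then obtain a b where "b \<in> H" "r = (\<lambda>x. a + b \<bullet> x)" by (auto simp: P1_def)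
  then have "r = (\<lambda>x. (a + b \<bullet> p) + b \<bullet> (x - p))" by (auto simp: inner_diff_right)
  then show "r \<in> {(\<lambda>x. a + b \<bullet> (x - p)) | a b. b \<in> H}" using \<open>b \<in> H\<close> by blast
next
  fix r assume "r \<in> {(\<lambda>x. a + b \<bullet> (x - p)) | a b. b \<in> H}"
  then obtain a b where "b \<in> H" "r = (\<lambda>x. a + b \<bullet> (x - p))" by blast
  then have "r = (\<lambda>x. (a - b \<bullet> p) + b \<bullet> x)" by (auto simp: inner_diff_right)
  then show "r \<in> P1 H" using \<open>b \<in> H\<close> unfolding P1_def by blast
qed

lemma radial_fields:
  "{\<lambda>x. r x *\<^sub>R (x - p) | r. r \<in> P1 H} = {\<lambda>x. (a + b \<bullet> (x - p)) *\<^sub>R (x - p) | a b. b \<in> H}"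
  (is "?A = ?B")
proof (intro equalityI subsetI)
  fix v assume "v \<in> ?A"
  then obtain r where r: "r \<in> P1 H" and v: "v = (\<lambda>x. r x *\<^sub>R (x - p))" by blast
  from r obtain a b where "b \<in> H" and r': "r = (\<lambda>x. a + b \<bullet> (x - p))" unfolding P1_eq by blast
  then show "v \<in> ?B" unfolding v r' by blast
next
  fix v assume "v \<in> ?B"
  then obtain a b where "b \<in> H" and v: "v = (\<lambda>x. (a + b \<bullet> (x - p)) *\<^sub>R (x - p))" by blast
  define r where "r = (\<lambda>x. a + b \<bullet> (x - p))"
  have "r \<in> P1 H" unfolding P1_eq r_def using \<open>b \<in> H\<close> by blast
  moreover have "v = (\<lambda>x. r x *\<^sub>R (x - p))" unfolding v r_def ..
  ultimately show "v \<in> ?A" by blast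
qed

text \<open>
  The factors \<open>k\<close> and \<open>l\<close> are those produced by the divergence of a radial field. They can be
  absorbed into the functional by rescaling its two arguments, which leaves the symmetric positive
  definite Gram form of the affine polynomials.
\<close>

lemma ex1_affine:
  assumes "k \<noteq> 0" "l \<noteq> 0" and \<Lambda>: "linear (\<Lambda> :: real \<times> pt3 \<Rightarrow> real)"
  shows "\<exists>!\<rho>. \<rho> \<in> P1 H \<and>
    (\<forall>a. \<forall>b\<in>H. I (\<lambda>x. \<rho> x * (k * a + l * (b \<bullet> (x - p)))) = \<Lambda> (a, b))"
proof -
  define A where "A z x = fst z + snd z \<bullet> (x - p)" for z :: "real \<times> pt3" and x
  have A: "linear (\<lambda>z. A z x)" for x
    unfolding A_def
    by (rule linearI) (auto simp: inner_add_left algebra_simps)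
  have cont: "continuous_on S (A z)" for z
    unfolding A_def by (intro continuous_intros)
  define \<beta> where "\<beta> z w = I (\<lambda>x. A z x * A w x)" for z w
  have A_mult: "linear (\<lambda>z. A z x * c)" "linear (\<lambda>z. c * A z x)" for x c
    using A[of x] by (auto simp: linear_iff algebra_simps)
  have \<beta>: "bilinear \<beta>"
    unfolding bilinear_def \<beta>_def
    by (intro conjI allI linear_integral A_mult continuous_intros cont)
  have pos: "z = 0" if "z \<in> UNIV \<times> H" "\<beta> z z = 0" for z
    using definite[of "snd z" "fst z"] that
    by (auto simp: \<beta>_def A_def power2_eq_square prod_eq_iff)
  have sub: "subspace (UNIV \<times> H :: (real \<times> pt3) set)"
    by (intro subspace_Times H subspace_UNIV)
  define \<sigma> where "\<sigma> z = (k * fst z, l *\<^sub>R snd z)" for z :: "real \<times> pt3"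
  define \<tau> where "\<tau> z = (fst z / k, snd z /\<^sub>R l)" for z :: "real \<times> pt3"
  have inv: "\<sigma> (\<tau> z) = z" "\<tau> (\<sigma> z) = z" for z using assms by (auto simp: \<sigma>_def \<tau>_def)
  have mem: "\<sigma> z \<in> UNIV \<times> H \<longleftrightarrow> z \<in> UNIV \<times> H" for z
  proof -
    have "\<sigma> z \<in> UNIV \<times> H" "\<tau> z \<in> UNIV \<times> H" if "z \<in> UNIV \<times> H" for z
      using that H by (auto simp: \<sigma>_def \<tau>_def subspace_scale)
    then show ?thesis using inv by metis
  qed
  have "linear \<tau>" unfolding \<tau>_def by (rule linearI) (auto simp: add_divide_distrib scaleR_add_right)
  then have "linear (\<Lambda> \<circ> \<tau>)" using \<Lambda> by (rule linear_compose)
  from ex1_representing_vector[OF sub \<beta> pos this]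
  have ex1: "\<exists>!z. z \<in> UNIV \<times> H \<and> (\<forall>w\<in>UNIV \<times> H. \<beta> z w = \<Lambda> (\<tau> w))" by simp
  have P1_A: "P1 H = A ` (UNIV \<times> H)"
  proof -
    have "A ` (UNIV \<times> H) = {(\<lambda>x. a + b \<bullet> (x - p)) | a b. b \<in> H}"
      by (force simp: A_def[abs_def])
    then show ?thesis by (simp add: P1_eq)
  qed
  have eq: "(\<forall>a. \<forall>b\<in>H. I (\<lambda>x. A z x * (k * a + l * (b \<bullet> (x - p)))) = \<Lambda> (a, b)) \<longleftrightarrow>
      (\<forall>w\<in>UNIV \<times> H. \<beta> z w = \<Lambda> (\<tau> w))" (is "?l \<longleftrightarrow> ?r") for z
  proof -
    have "?l \<longleftrightarrow> (\<forall>w\<in>UNIV \<times> H. \<beta> z (\<sigma> w) = \<Lambda> w)"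
      by (auto simp: \<beta>_def A_def \<sigma>_def)
    also have "\<dots> \<longleftrightarrow> ?r" using mem inv by metis
    finally show ?thesis .
  qed
  from ex1 obtain z where z: "z \<in> UNIV \<times> H" "\<forall>w\<in>UNIV \<times> H. \<beta> z w = \<Lambda> (\<tau> w)" by blast
  show ?thesis
  proof (rule ex1I[of _ "A z"])
    show "A z \<in> P1 H \<and> (\<forall>a. \<forall>b\<in>H. I (\<lambda>x. A z x * (k * a + l * (b \<bullet> (x - p)))) = \<Lambda> (a, b))"
      using z eq P1_A by blast
    fix \<rho> assume *: "\<rho> \<in> P1 H \<and> (\<forall>a. \<forall>b\<in>H. I (\<lambda>x. \<rho> x * (k * a + l * (b \<bullet> (x - p)))) = \<Lambda> (a, b))"
    then obtain w where w: "w \<in> UNIV \<times> H" "\<rho> = A w" using P1_A by blast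
    then have "\<forall>v\<in>UNIV \<times> H. \<beta> w v = \<Lambda> (\<tau> v)" using * eq by blast
    then have "w = z" using w(1) z ex1 by blast
    then show "\<rho> = A z" using w(2) by simp
  qed
qed

text \<open>
  A mean-free affine polynomial is determined by its gradient; this is the one with gradient \<open>b\<close>.
\<close>

definition zero_mean :: "pt3 \<Rightarrow> pt3 \<Rightarrow> real" where
  "zero_mean b x = b \<bullet> (x - p) - I (\<lambda>y. b \<bullet> (y - p)) / I (\<lambda>y. 1)"

lemma linear_zero_mean: "linear (\<lambda>b. zero_mean b x)"
proof -
  have "linear (\<lambda>b. I (\<lambda>y. b \<bullet> (y - p)))"
    by (rule linear_integral) (auto intro!: continuous_intros linearI simp: inner_add_left)
  then show ?thesis unfolding zero_mean_def
    by (auto simp: linear_iff inner_add_left diff_divide_distrib add_divide_distrib algebra_simps)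
qed

lemma continuous_zero_mean: "continuous_on A (zero_mean b)"
  unfolding zero_mean_def by (intro continuous_intros)

lemma zero_mean_polynomials: "{r \<in> P1 H. I r = 0} = zero_mean ` H"
proof -
  have *: "I (\<lambda>x. a + b \<bullet> (x - p)) = a * I (\<lambda>x. 1) + I (\<lambda>x. b \<bullet> (x - p))" for a b
    by (subst add) (auto intro!: continuous_intros simp: const[of a])
  have **: "zero_mean b = (\<lambda>x. - I (\<lambda>y. b \<bullet> (y - p)) / I (\<lambda>y. 1) + b \<bullet> (x - p))" for b
    by (auto simp: zero_mean_def)
  show ?thesis
  proof (intro equalityI subsetI)
    fix r assume r: "r \<in> {r \<in> P1 H. I r = 0}"
    then obtain a b where b: "b \<in> H" "r = (\<lambda>x. a + b \<bullet> (x - p))" by (auto simp: P1_eq)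
    then have "a = - I (\<lambda>x. b \<bullet> (x - p)) / I (\<lambda>x. 1)"
      using r * measure_nonzero by (simp add: field_simps)
    then show "r \<in> zero_mean ` H" using b ** by auto
  next
    fix r assume "r \<in> zero_mean ` H"
    then obtain b where b: "b \<in> H" "r = zero_mean b" by blast
    then have "r \<in> P1 H" unfolding P1_eq ** by blast
    moreover have "I r = 0" unfolding b(2) ** * using measure_nonzero by simp
    ultimately show "r \<in> {r \<in> P1 H. I r = 0}" by blast
  qed
qed

end

text \<open>
  Compactness of the parameter domain makes every continuous function on the cell integrable,
  which is what additivity of the integral needs.
\<close>

lemma cell_integral_parametrized:
  fixes \<phi> :: "'b::euclidean_space \<Rightarrow> pt3"
  assumes K: "compact {z. \<phi> z \<in> S}" and \<phi>: "continuous_on UNIV \<phi>"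
  shows "cell_integral S (\<lambda>f. LINT z:{z. \<phi> z \<in> S}|lborel. f (\<phi> z))"
proof
  have int: "set_integrable lborel {z. \<phi> z \<in> S} (\<lambda>z. f (\<phi> z))"
    if "continuous_on S f" for f :: "pt3 \<Rightarrow> real"
    unfolding set_integrable_def
    by (rule borel_integrable_compact[OF K], rule continuous_on_compose2[OF that])
       (auto intro: continuous_on_subset[OF \<phi>])
  fix f g :: "pt3 \<Rightarrow> real" assume "continuous_on S f" "continuous_on S g"
  then show "(LINT z:{z. \<phi> z \<in> S}|lborel. f (\<phi> z) + g (\<phi> z)) =
    (LINT z:{z. \<phi> z \<in> S}|lborel. f (\<phi> z)) + (LINT z:{z. \<phi> z \<in> S}|lborel. g (\<phi> z))"
    using int by (simp add: set_integral_add)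
next
  fix c and f :: "pt3 \<Rightarrow> real"
  show "(LINT z:{z. \<phi> z \<in> S}|lborel. c * f (\<phi> z)) = c * (LINT z:{z. \<phi> z \<in> S}|lborel. f (\<phi> z))"
    by simp
next
  fix f g :: "pt3 \<Rightarrow> real" assume "\<And>x. x \<in> S \<Longrightarrow> f x = g x"
  then show "(LINT z:{z. \<phi> z \<in> S}|lborel. f (\<phi> z)) = (LINT z:{z. \<phi> z \<in> S}|lborel. g (\<phi> z))"
    unfolding set_lebesgue_integral_def
    by (intro Bochner_Integration.integral_cong) (auto simp: indicator_def)
qed

text \<open>
  An affine function whose square has integral zero vanishes almost everywhere, hence by
  continuity on the interior, and an affine function that vanishes on a ball is zero.
\<close>

lemma affine_eq_0_of_square_integral:
  fixes K :: "'b::euclidean_space set"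
  assumes K: "compact K" "interior K \<noteq> {}"
    and 0: "(LINT z:K|lborel. (a + c \<bullet> z)\<^sup>2) = 0"
  shows "a = 0 \<and> c = 0"
proof -
  have "integrable lborel (\<lambda>z. indicator K z *\<^sub>R (a + c \<bullet> z)\<^sup>2)"
    by (rule borel_integrable_compact[OF K(1)]) (intro continuous_intros)
  then have ae: "AE z in lborel. indicator K z *\<^sub>R (a + c \<bullet> z)\<^sup>2 = 0"
    using 0 unfolding set_lebesgue_integral_def
    by (subst (asm) integral_nonneg_eq_0_iff_AE) auto
  define W where "W = interior K \<inter> {z. a + c \<bullet> z \<noteq> 0}"
  have "open W" unfolding W_def
    by (intro open_Int open_interior open_Collect_neq continuous_intros)
  have "AE z in lborel. z \<notin> W"
    using ae by eventually_elim (use interior_subset in \<open>auto simp: W_def indicator_def\<close>)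
  then have "W \<in> null_sets lborel"
    using \<open>open W\<close> by (subst AE_iff_null_sets) auto
  then have "W = {}"
    using \<open>open W\<close> open_not_negligible negligible_iff_null_sets null_sets_completionI by blast
  then have zero: "a + c \<bullet> z = 0" if "z \<in> interior K" for z using that by (auto simp: W_def)
  obtain z where "z \<in> interior K" using K(2) by blast
  then obtain e where e: "e > 0" "ball z e \<subseteq> interior K"
    using open_interior open_contains_ball by blast
  \<comment> \<open>A step along \<open>c\<close> short enough to stay in the ball changes the value by \<open>\<epsilon> * (c \<bullet> c)\<close>.\<close>
  define d where "d = norm c + 1"
  have "d > 0" unfolding d_def by (simp add: add_nonneg_pos)
  define \<epsilon> where "\<epsilon> = e / 2 / d"
  have "\<epsilon> > 0" and "\<epsilon> * d = e / 2" unfolding \<epsilon>_def using e(1) \<open>d > 0\<close> by auto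
  then have "\<epsilon> * norm c < e" using e(1) by (simp add: d_def distrib_left)
  then have "z + \<epsilon> *\<^sub>R c \<in> ball z e" using e(1) \<open>\<epsilon> > 0\<close> by (simp add: dist_norm)
  then have "a + c \<bullet> (z + \<epsilon> *\<^sub>R c) = 0" using zero e(2) by blast
  moreover have "a + c \<bullet> z = 0" using zero \<open>z \<in> interior K\<close> .
  ultimately have "\<epsilon> * (c \<bullet> c) = 0" unfolding inner_add_right inner_scaleR_right by linarith
  then have "c = 0" using \<open>\<epsilon> > 0\<close> by simp
  then show ?thesis using \<open>a + c \<bullet> z = 0\<close> by simp
qed

lemma flat_cell_parametrized:
  fixes \<phi> :: "'b::euclidean_space \<Rightarrow> pt3"
  assumes K: "compact {z. \<phi> z \<in> S}" "interior {z. \<phi> z \<in> S} \<noteq> {}"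
    and \<phi>: "linear l" "\<And>z. \<phi> z = p0 + l z"
    and H: "subspace H" "\<And>b. b \<in> H \<Longrightarrow> (\<And>z. b \<bullet> l z = 0) \<Longrightarrow> b = 0"
  shows "flat_cell S (\<lambda>f. LINT z:{z. \<phi> z \<in> S}|lborel. f (\<phi> z)) H p"
proof -
  have "\<phi> = (\<lambda>z. p0 + l z)" using \<phi>(2) by auto
  moreover have "continuous_on UNIV l"
    using \<phi>(1) linear_continuous_on linear_conv_bounded_linear by blast
  ultimately have cont: "continuous_on UNIV \<phi>" by (auto intro!: continuous_intros)
  interpret cell_integral S "\<lambda>f. LINT z:{z. \<phi> z \<in> S}|lborel. f (\<phi> z)"
    by (rule cell_integral_parametrized[OF K(1) cont])
  show ?thesis
  proof
    show "S \<noteq> {}" using K(2) by auto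
    fix a b assume b: "b \<in> H" and 0: "(LINT z:{z. \<phi> z \<in> S}|lborel. (a + b \<bullet> (\<phi> z - p))\<^sup>2) = 0"
    have *: "a + b \<bullet> (\<phi> z - p) = (a + b \<bullet> (p0 - p)) + adjoint l b \<bullet> z" for z
      by (simp add: \<phi>(2) inner_add_right inner_diff_right adjoint_clauses(2)[OF \<phi>(1)])
    have **: "a + b \<bullet> (p0 - p) = 0 \<and> adjoint l b = 0"
      using affine_eq_0_of_square_integral[OF K, of "a + b \<bullet> (p0 - p)" "adjoint l b"] 0
      by (simp only: *)
    have "b \<bullet> l z = 0" for z using ** by (metis adjoint_clauses(2)[OF \<phi>(1)] inner_zero_left)
    then have "b = 0" by (rule H(2)[OF b])
    then show "a = 0 \<and> b = 0" using ** by simp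
  qed (rule H(1))
qed

section \<open>Elements, faces and edges of a mesh as cells\<close>

lemma polyhedral_set_compact: "polyhedral_set d S \<Longrightarrow> compact S"
  unfolding polyhedral_set_def using polytope_imp_compact by (auto intro!: compact_Union)

lemma polyhedral_set_contains_polytope:
  assumes "polyhedral_set d S" "d \<ge> 0"
  obtains P where "polytope P" "P \<subseteq> S" "aff_dim P = d" "rel_interior P \<noteq> {}"
proof -
  from assms obtain \<P> where P: "S = \<Union>\<P>" "\<forall>P\<in>\<P>. polytope P \<and> aff_dim P = d" "aff_dim S = d"
    unfolding polyhedral_set_def by blast
  have "S \<noteq> {}" using P(3) assms(2) by auto
  then obtain P where "P \<in> \<P>" using P(1) by blast
  moreover from this have "P \<noteq> {}" using P(2) assms(2) by auto
  ultimately show thesis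
    using that[of P] P by (auto simp: rel_interior_eq_empty polytope_imp_convex)
qed

text \<open>
  The chart of a face used by \<open>intF\<close>, with the choice of the frame made explicit.
\<close>

definition face_tangent :: "mesh \<Rightarrow> pt3 set \<Rightarrow> pt3" where
  "face_tangent M F = (SOME u. norm u = 1 \<and> u \<bullet> nrm M F = 0)"

definition face_chart :: "mesh \<Rightarrow> pt3 set \<Rightarrow> real \<times> real \<Rightarrow> pt3" where
  "face_chart M F z = pnt M F + (fst z *\<^sub>R face_tangent M F
     + snd z *\<^sub>R cross3 (nrm M F) (face_tangent M F))"

lemma intF_eq: "intF M F = (\<lambda>f. LINT z:{z. face_chart M F z \<in> F}|lborel. f (face_chart M F z))"
proof
  fix f
  have "(\<lambda>(s, r). pnt M F + s *\<^sub>R u + r *\<^sub>R cross3 (nrm M F) u) =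
    (\<lambda>z. pnt M F + (fst z *\<^sub>R u + snd z *\<^sub>R cross3 (nrm M F) u))" for u
    by (auto simp: algebra_simps)
  then show "intF M F f = (LINT z:{z. face_chart M F z \<in> F}|lborel. f (face_chart M F z))"
    unfolding intF_def Let_def face_chart_def face_tangent_def by simp
qed

lemma face_tangent:
  "norm (face_tangent M F) = 1" "face_tangent M F \<bullet> nrm M F = 0"
proof -
  obtain y where y: "y \<noteq> 0" "orthogonal (nrm M F) y"
    using orthogonal_to_vector_exists[of "nrm M F"] by auto
  then have "norm (y /\<^sub>R norm y) = 1 \<and> (y /\<^sub>R norm y) \<bullet> nrm M F = 0"
    by (auto simp: orthogonal_def inner_commute)
  then have "norm (face_tangent M F) = 1 \<and> face_tangent M F \<bullet> nrm M F = 0"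
    unfolding face_tangent_def by (rule someI)
  then show "norm (face_tangent M F) = 1" "face_tangent M F \<bullet> nrm M F = 0" by auto
qed

lemma subspace_tplane: "subspace (tplane M F)"
  unfolding tplane_def by (auto simp: subspace_def inner_add_left)

lemma cross3_in_tplane: "cross3 b (nrm M F) \<in> tplane M F" "cross3 (nrm M F) b \<in> tplane M F"
  by (auto simp: tplane_def dot_cross_self)

text \<open>
  On the tangent plane the two quarter turns about the unit normal are inverse to each other.
\<close>

lemma cross3_tplane:
  assumes "norm (nrm M F) = 1" "b \<in> tplane M F"
  shows "cross3 (cross3 (nrm M F) b) (nrm M F) = b" "cross3 (nrm M F) (cross3 b (nrm M F)) = b"
proof -
  have n: "nrm M F \<bullet> nrm M F = 1" using assms(1) by (simp add: norm_eq_1)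
  have b: "b \<bullet> nrm M F = 0" using assms(2) by (simp add: tplane_def)
  have *: "cross3 (cross3 a b) c = (a \<bullet> c) *\<^sub>R b - (b \<bullet> c) *\<^sub>R a" 
    "cross3 c (cross3 b a) = (a \<bullet> c) *\<^sub>R b - (b \<bullet> c) *\<^sub>R a" for a b c
    by (auto simp: cross3_simps forall_3)
  show "cross3 (cross3 (nrm M F) b) (nrm M F) = b" "cross3 (nrm M F) (cross3 b (nrm M F)) = b"
    using n b by (simp_all add: *)
qed

lemma compact_vimage_of_norm_eq:
  fixes \<phi> :: "'b::euclidean_space \<Rightarrow> pt3"
  assumes S: "compact S" and \<phi>: "linear l" "\<And>z. \<phi> z = p0 + l z" "\<And>z. norm (l z) = norm z"
  shows "compact {z. \<phi> z \<in> S}"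
proof -
  have "\<phi> = (\<lambda>z. p0 + l z)" using \<phi>(2) by auto
  moreover have "continuous_on UNIV l"
    using \<phi>(1) linear_continuous_on linear_conv_bounded_linear by blast
  ultimately have cont: "continuous_on UNIV \<phi>" by (auto intro!: continuous_intros)
  have "closed (\<phi> -` S)"
    by (intro closed_vimage compact_imp_closed S cont)
  moreover obtain B where B: "\<And>x. x \<in> S \<Longrightarrow> norm x \<le> B"
    using compact_imp_bounded[OF S] by (auto simp: bounded_iff)
  have "norm z \<le> B + norm p0" if "\<phi> z \<in> S" for z
    using B[OF that] \<phi>(3)[of z] norm_triangle_ineq4[of "\<phi> z" p0] by (simp add: \<phi>(2))
  then have "bounded {z. \<phi> z \<in> S}" by (auto simp: bounded_iff)
  ultimately show ?thesis by (simp add: compact_eq_bounded_closed vimage_def)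
qed

locale meshed =
  fixes M :: mesh
  assumes mesh: "polyhedral_mesh M"
begin

lemma finite_elems: "finite (elems M)"
  using mesh by (auto simp: polyhedral_mesh_def)

lemma facesT_subset: "facesT M T \<subseteq> faces M" by (auto simp: facesT_def)

lemma edgesF_subset: "edgesF M F \<subseteq> edges M" by (auto simp: edgesF_def)

lemma edgesT_subset: "edgesT M F \<subseteq> edges M" by (auto simp: edgesT_def)

lemma unit_normal: "F \<in> faces M \<Longrightarrow> norm (nrm M F) = 1"
  using mesh by (auto simp: polyhedral_mesh_def)

lemma element_cell:
  assumes "T \<in> elems M"
  shows "flat_cell T (intT T) UNIV (pnt M T)"
proof -
  have T: "polyhedral_set 3 T" using assms mesh by (simp add: polyhedral_mesh_def)
  obtain P where P: "P \<subseteq> T" "aff_dim P = 3" "rel_interior P \<noteq> {}"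
    by (rule polyhedral_set_contains_polytope[OF T]) simp_all
  have "affine hull P = UNIV" using P(2) aff_dim_eq_full[of P] by simp
  then have "interior P \<noteq> {}" using P(3) by (simp add: rel_interior_interior)
  then have "interior T \<noteq> {}" using interior_mono[OF P(1)] by blast
  have "flat_cell T (\<lambda>f. LINT z:{z. z \<in> T}|lborel. f z) UNIV (pnt M T)"
    by (rule flat_cell_parametrized[where l = "\<lambda>z. z" and ?p0.0 = 0])
       (use polyhedral_set_compact[OF T] \<open>interior T \<noteq> {}\<close> in \<open>auto intro: inner_eq_zero_iff[THEN iffD1] simp: linear_iff\<close>)
  then show ?thesis by (simp add: intT_def[abs_def])
qed

text \<open>
  A two-dimensional polytope inside the face spans the whole plane of the face, so its relative
  interior is open in that plane and the isometric chart pulls it back to an open set.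
\<close>

lemma face_cell:
  assumes "F \<in> faces M"
  shows "flat_cell F (intF M F) (tplane M F) (pnt M F)"
proof -
  let ?n = "nrm M F" and ?u = "face_tangent M F" and ?p = "pnt M F" and ?\<phi> = "face_chart M F"
  let ?w = "cross3 ?n ?u"
  define l where "l z = fst z *\<^sub>R ?u + snd z *\<^sub>R ?w" for z :: "real \<times> real"
  have F: "polyhedral_set 2 F" and n: "norm ?n = 1" and p: "?p \<in> F"
    and plane: "\<And>x y. x \<in> F \<Longrightarrow> y \<in> F \<Longrightarrow> (x - y) \<bullet> ?n = 0"
    using assms mesh by (auto simp: polyhedral_mesh_def)
  have \<phi>: "?\<phi> z = ?p + l z" for z by (simp add: face_chart_def l_def)
  have l: "linear l" unfolding l_def
    by (rule linearI) (auto simp: algebra_simps)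
  have uu: "?u \<bullet> ?u = 1" and un: "?u \<bullet> ?n = 0" using face_tangent by (auto simp: norm_eq_1)
  have "(norm ?w)\<^sup>2 = 1"
    using norm_cross_dot[of ?n ?u] n face_tangent by (simp add: inner_commute)
  then have ww: "?w \<bullet> ?w = 1" by (simp add: power2_norm_eq_inner)
  have uw: "?u \<bullet> ?w = 0" "?w \<bullet> ?u = 0" by (simp_all add: dot_cross_self)
  have norm_l: "norm (l z) = norm z" for z
    unfolding norm_eq_sqrt_inner l_def
    by (simp add: inner_add_left inner_add_right uu ww uw inner_prod_def power2_eq_square)
  have def_H: "b = 0" if b: "b \<in> tplane M F" and 0: "\<And>z. b \<bullet> l z = 0" for b
  proof -
    have bu: "b \<bullet> ?u = 0" and bw: "b \<bullet> ?w = 0"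
      using 0[of "(1, 0)"] 0[of "(0, 1)"] by (simp_all add: l_def)
    have "cross3 b ?w = (b \<bullet> ?u) *\<^sub>R ?n - (b \<bullet> ?n) *\<^sub>R ?u"
      by (auto simp: cross3_simps forall_3)
    also have "\<dots> = 0" using bu b by (simp add: tplane_def)
    finally have "(norm b)\<^sup>2 * (norm ?w)\<^sup>2 = 0"
      using norm_cross_dot[of b ?w] bw by (simp add: power_mult_distrib)
    then show "b = 0" using \<open>(norm ?w)\<^sup>2 = 1\<close> by simp
  qed
  have comp: "compact {z. ?\<phi> z \<in> F}"
    by (rule compact_vimage_of_norm_eq[OF polyhedral_set_compact[OF F] l \<phi> norm_l])
  have int: "interior {z. ?\<phi> z \<in> F} \<noteq> {}"
  proof -
    define A where "A = {x. ?n \<bullet> x = ?n \<bullet> ?p}"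
    have F_A: "F \<subseteq> A"
      using plane[OF _ p] by (auto simp: A_def inner_diff_left inner_commute[of ?n])
    obtain P where P: "polytope P" "P \<subseteq> F" "aff_dim P = 2" "rel_interior P \<noteq> {}"
      by (rule polyhedral_set_contains_polytope[OF F]) simp_all
    have "?n \<noteq> 0" using n by auto
    then have dimA: "aff_dim A = 2" by (simp add: A_def aff_dim_hyperplane)
    have "affine hull P = A"
    proof (rule affine_dim_equal)
      show "affine A" unfolding A_def by (rule affine_hyperplane)
      then show "affine hull P \<subseteq> A" using P(2) F_A by (intro hull_minimal) auto
      show "affine hull P \<noteq> {}" using P(3) rel_interior_subset by force
    qed (use dimA P(3) in auto)
    then obtain x e where x: "x \<in> P" "e > 0" "ball x e \<inter> A \<subseteq> P"
      using P(4) by (auto simp: rel_interior_ball)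
    have "x \<in> A" using x(1) P(2) F_A by auto
    have \<phi>A: "?\<phi> z \<in> A" for z
      by (simp add: A_def \<phi> l_def inner_add_right un[unfolded inner_commute[of ?u]] dot_cross_self)
    let ?z = "((x - ?p) \<bullet> ?u, (x - ?p) \<bullet> ?w)"
    have "x - ?p - l ?z \<in> tplane M F"
      using \<open>x \<in> A\<close> \<phi>A[of ?z] by (simp add: A_def \<phi> tplane_def inner_diff_left inner_add_left inner_diff_right
          inner_add_right inner_commute[of _ ?n])
    moreover have "(x - ?p - l ?z) \<bullet> l z = 0" for z
      by (simp add: l_def inner_add_right inner_diff_left[of "x - ?p"] inner_add_left uu ww uw)
    ultimately have "x - ?p - l ?z = 0" by (rule def_H)
    then have x_eq: "x = ?\<phi> ?z" by (simp add: \<phi>)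
    have "ball ?z e \<subseteq> {z. ?\<phi> z \<in> F}"
    proof
      fix z assume z: "z \<in> ball ?z e"
      have "x - ?\<phi> z = l (?z - z)" by (subst x_eq) (simp add: \<phi> linear_diff[OF l])
      then have "dist x (?\<phi> z) = dist ?z z" by (simp add: dist_norm norm_l)
      then have "?\<phi> z \<in> ball x e" using z by simp
      then show "z \<in> {z. ?\<phi> z \<in> F}" using x(3) \<phi>A P(2) by blast
    qed
    then have "?z \<in> interior {z. ?\<phi> z \<in> F}"
      using x(2) by (meson centre_in_ball interior_maximal open_ball subsetD)
    then show ?thesis by blast
  qed
  show ?thesis
    unfolding intF_eq
    by (rule flat_cell_parametrized[OF comp int l \<phi> subspace_tplane def_H])
qed

lemma edge_cell:
  assumes "e \<in> edges M"
  shows "cell_integral e (intE M e)"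
proof -
  let ?\<phi> = "\<lambda>s. pnt M e + s *\<^sub>R tang M e"
  have e: "compact e" "norm (tang M e) = 1"
    using assms mesh by (auto simp: polyhedral_mesh_def)
  have "compact {s. ?\<phi> s \<in> e}"
    by (rule compact_vimage_of_norm_eq[OF e(1), where l = "\<lambda>s. s *\<^sub>R tang M e" and ?p0.0 = "pnt M e"])
       (auto simp: e(2) intro!: linearI algebra_simps)
  then have "cell_integral e (\<lambda>f. LINT s:{s. ?\<phi> s \<in> e}|lborel. f (?\<phi> s))"
    by (rule cell_integral_parametrized) (intro continuous_intros)
  then show ?thesis by (simp add: intE_def[abs_def])
qed

end

section \<open>Derivatives of affine and radial fields\<close>

lemma jacobian_eq: "(v has_derivative D) (at x) \<Longrightarrow> jacobian v (at x) = matrix D"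
  unfolding jacobian_def by (simp flip: frechet_derivative_at)

lemma derivative_radial:
  fixes p x b :: pt3
  shows "((\<lambda>x. (a + b \<bullet> (x - p)) *\<^sub>R (x - p)) has_derivative
    (\<lambda>h. (a + b \<bullet> (x - p)) *\<^sub>R h + (b \<bullet> h) *\<^sub>R (x - p))) (at x)"
  by (auto intro!: derivative_eq_intros)

text \<open>
  The coefficients 3 and 4 here, and 2 and 3 for the tangential divergence below, are the
  dimension and its successor: the linear part of the radial field is homogeneous of degree two.
\<close>

lemma divergence_radial:
  "divergence (\<lambda>x. (a + b \<bullet> (x - p)) *\<^sub>R (x - p)) x = 3 * a + 4 * (b \<bullet> (x - p))"
  unfolding divergence_def jacobian_eq[OF derivative_radial]
  by (simp add: trace_def matrix_def sum_3 inner_vec_def axis_def algebra_simps)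

lemma divF_radial:
  assumes "norm (nrm M F) = 1" "b \<in> tplane M F"
  shows "divF M F (\<lambda>x. (a + b \<bullet> (x - p)) *\<^sub>R (x - p)) x = 2 * a + 3 * (b \<bullet> (x - p))"
proof -
  let ?D = "\<lambda>h. (a + b \<bullet> (x - p)) *\<^sub>R h + (b \<bullet> h) *\<^sub>R (x - p)"
  have "linear ?D" using derivative_radial has_derivative_linear by blast
  then have "jacobian (\<lambda>x. (a + b \<bullet> (x - p)) *\<^sub>R (x - p)) (at x) *v nrm M F = ?D (nrm M F)"
    unfolding jacobian_eq[OF derivative_radial] by (simp add: matrix_works)
  moreover have "b \<bullet> nrm M F = 0" "nrm M F \<bullet> nrm M F = 1"
    using assms by (auto simp: tplane_def norm_eq_1)
  ultimately show ?thesis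
    unfolding divF_def divergence_radial by simp
qed

lemma curl_rotation: "curl (\<lambda>x. cross3 (x - p) c) x = - 2 *\<^sub>R c"
proof -
  have "((\<lambda>x. cross3 (x - p) c) has_derivative (\<lambda>h. cross3 h c)) (at x)"
    using bilinear_cross bilinear_conv_bounded_bilinear
    by (auto intro!: derivative_eq_intros bounded_linear_imp_has_derivative
        bounded_bilinear.bounded_linear_left simp: Cross3.left_diff_distrib)
  from jacobian_eq[OF this] show ?thesis
    unfolding curl_def by (simp add: matrix_def cross3_def vec_eq_iff forall_3 axis_def)
qed

lemma grad_affine: "grad (\<lambda>x. a + b \<bullet> (x - p)) x = b"
proof -
  have *: "GDERIV (\<lambda>x. a + b \<bullet> (x - p)) x :> b"
    unfolding gderiv_def by (auto intro!: derivative_eq_intros simp: inner_commute)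
  then show ?thesis unfolding grad_def
  proof (rule the_equality)
    fix D assume "GDERIV (\<lambda>x. a + b \<bullet> (x - p)) x :> D"
    then have "(\<lambda>h. h \<bullet> D) = (\<lambda>h. h \<bullet> b)"
      using * has_derivative_unique unfolding gderiv_def by blast
    then show "D = b" by (metis vector_eq_ldot)
  qed
qed

lemma rotF_affine:
  assumes "b \<in> tplane M F"
  shows "rotF M F (\<lambda>x. a + b \<bullet> (x - p)) x = cross3 b (nrm M F)"
  using assms by (simp add: rotF_def gradF_def grad_affine tplane_def)

section \<open>Linearity of the potentials in the edge values\<close>

text \<open>
  Linearity and dependence on the edge values only, in a single condition: taking \<open>a = 1\<close> and
  \<open>b = 0\<close> shows that families agreeing on the edges have the same image.
\<close>

definition edge_linear :: "mesh \<Rightarrow> ((pt3 set \<Rightarrow> real) \<Rightarrow> 'a::real_vector) \<Rightarrow> bool" where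
  "edge_linear M L \<longleftrightarrow>
     (\<forall>a v b w u. (\<forall>e\<in>edges M. u e = a * v e + b * w e) \<longrightarrow> L u = a *\<^sub>R L v + b *\<^sub>R L w)"

lemma edge_linearD:
  "edge_linear M L \<Longrightarrow> (\<And>e. e \<in> edges M \<Longrightarrow> u e = a * v e + b * w e) \<Longrightarrow>
   L u = a *\<^sub>R L v + b *\<^sub>R L w"
  unfolding edge_linear_def by blast

lemma edge_linearI:
  "(\<And>a v b w u. (\<And>e. e \<in> edges M \<Longrightarrow> u e = a * v e + b * w e) \<Longrightarrow>
    L u = a *\<^sub>R L v + b *\<^sub>R L w) \<Longrightarrow> edge_linear M L"
  unfolding edge_linear_def by blast

lemma edge_linear_value: "e \<in> edges M \<Longrightarrow> edge_linear M (\<lambda>v. v e)"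
  unfolding edge_linear_def by auto

lemma edge_linear_compose:
  assumes "linear f" "edge_linear M L"
  shows "edge_linear M (\<lambda>v. f (L v))"
proof (rule edge_linearI)
  fix a b :: real and u v w :: "pt3 set \<Rightarrow> real"
  assume "\<And>e. e \<in> edges M \<Longrightarrow> u e = a * v e + b * w e"
  then have "L u = a *\<^sub>R L v + b *\<^sub>R L w" by (rule edge_linearD[OF assms(2)])
  then show "f (L u) = a *\<^sub>R f (L v) + b *\<^sub>R f (L w)"
    by (simp add: linear_add[OF assms(1)] linear_scale[OF assms(1)])
qed

lemma edge_linear_mult:
  "edge_linear M L \<Longrightarrow> edge_linear M (\<lambda>v. c * L v)"
  "edge_linear M L \<Longrightarrow> edge_linear M (\<lambda>v. L v * c)" for c :: real
  by (rule edge_linear_compose[where L = L]; simp add: linear_iff algebra_simps)+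

lemma edge_linear_sum:
  assumes "\<And>i. i \<in> J \<Longrightarrow> edge_linear M (L i)"
  shows "edge_linear M (\<lambda>v. \<Sum>i\<in>J. L i v)"
proof (rule edge_linearI)
  fix a b :: real and u v w :: "pt3 set \<Rightarrow> real"
  assume "\<And>e. e \<in> edges M \<Longrightarrow> u e = a * v e + b * w e"
  then have "(\<Sum>i\<in>J. L i u) = (\<Sum>i\<in>J. a *\<^sub>R L i v + b *\<^sub>R L i w)"
    by (intro sum.cong refl edge_linearD[OF assms])
  then show "(\<Sum>i\<in>J. L i u) = a *\<^sub>R (\<Sum>i\<in>J. L i v) + b *\<^sub>R (\<Sum>i\<in>J. L i w)"
    by (simp add: sum.distrib scaleR_sum_right)
qed

lemma edge_linear_add:
  assumes "edge_linear M L" "edge_linear M L'"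
  shows "edge_linear M (\<lambda>v. L v + L' v)"
proof (rule edge_linearI)
  fix a b :: real and u v w :: "pt3 set \<Rightarrow> real"
  assume "\<And>e. e \<in> edges M \<Longrightarrow> u e = a * v e + b * w e"
  from edge_linearD[OF assms(1) this] edge_linearD[OF assms(2) this]
  show "L u + L' u = a *\<^sub>R (L v + L' v) + b *\<^sub>R (L w + L' w)"
    by (simp add: scaleR_add_right)
qed

lemma edge_linear_diff:
  "edge_linear M L \<Longrightarrow> edge_linear M L' \<Longrightarrow> edge_linear M (\<lambda>v. L v - L' v)"
  using edge_linear_add[OF _ edge_linear_compose[of uminus M L'], of L]
  by (simp add: linear_iff)

lemma edge_linear_inner:
  "edge_linear M L \<Longrightarrow> edge_linear M (\<lambda>v. L v \<bullet> c)"
  by (rule edge_linear_compose[where L = L]) (simp_all add: linear_iff inner_add_left)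

text \<open>
  The step from data to solution that all potentials of the curl space have in common: a linear
  combination of the representing vectors solves the problem for the combined data, so by
  uniqueness it is the solution.
\<close>

lemma edge_linear_represented:
  fixes \<Lambda> :: "(pt3 set \<Rightarrow> real) \<Rightarrow> 'a::euclidean_space \<Rightarrow> real"
  assumes S: "subspace S" and lin: "\<And>v. linear (\<Lambda> v)"
    and \<Lambda>: "\<And>\<xi>. \<xi> \<in> S \<Longrightarrow> edge_linear M (\<lambda>v. \<Lambda> v \<xi>)"
  shows "edge_linear M (\<lambda>v. THE g. g \<in> S \<and> (\<forall>\<xi>\<in>S. g \<bullet> \<xi> = \<Lambda> v \<xi>))"
proof (rule edge_linearI)
  fix a b :: real and u v w :: "pt3 set \<Rightarrow> real"
  assume u: "\<And>e. e \<in> edges M \<Longrightarrow> u e = a * v e + b * w e"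
  define R where "R v = (THE g. g \<in> S \<and> (\<forall>\<xi>\<in>S. g \<bullet> \<xi> = \<Lambda> v \<xi>))" for v
  have ex1: "\<exists>!g. g \<in> S \<and> (\<forall>\<xi>\<in>S. g \<bullet> \<xi> = \<Lambda> v \<xi>)" for v
    by (rule ex1_representing_vector[OF S _ _ lin])
       (auto simp: bilinear_def linear_iff inner_add_left inner_add_right)
  have R: "R v \<in> S" "\<xi> \<in> S \<Longrightarrow> R v \<bullet> \<xi> = \<Lambda> v \<xi>" for v \<xi>
    using theI'[OF ex1[of v]] unfolding R_def by auto
  have "R u = a *\<^sub>R R v + b *\<^sub>R R w"
    unfolding R_def[of u]
  proof (rule the1_equality[OF ex1], intro conjI ballI)
    show "a *\<^sub>R R v + b *\<^sub>R R w \<in> S" using S R(1) by (intro subspace_add subspace_scale)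
    fix \<xi> assume \<xi>: "\<xi> \<in> S"
    have "\<Lambda> u \<xi> = a *\<^sub>R \<Lambda> v \<xi> + b *\<^sub>R \<Lambda> w \<xi>"
      using u by (rule edge_linearD[OF \<Lambda>[OF \<xi>]])
    then show "(a *\<^sub>R R v + b *\<^sub>R R w) \<bullet> \<xi> = \<Lambda> u \<xi>"
      by (simp add: inner_add_left R(2)[OF \<xi>])
  qed
  then show "(THE g. g \<in> S \<and> (\<forall>\<xi>\<in>S. g \<bullet> \<xi> = \<Lambda> u \<xi>)) =
      a *\<^sub>R (THE g. g \<in> S \<and> (\<forall>\<xi>\<in>S. g \<bullet> \<xi> = \<Lambda> v \<xi>)) +
      b *\<^sub>R (THE g. g \<in> S \<and> (\<forall>\<xi>\<in>S. g \<bullet> \<xi> = \<Lambda> w \<xi>))"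
    unfolding R_def .
qed

lemma (in cell_integral) edge_linear_integral:
  assumes "\<And>x. x \<in> S \<Longrightarrow> edge_linear M (\<lambda>v. L v x)" and "\<And>v. continuous_on S (L v)"
  shows "edge_linear M (\<lambda>v. I (L v))"
proof (rule edge_linearI)
  fix a b :: real and u v w :: "pt3 set \<Rightarrow> real"
  assume u: "\<And>e. e \<in> edges M \<Longrightarrow> u e = a * v e + b * w e"
  have "I (L u) = I (\<lambda>x. a * L v x + b * L w x)"
    by (rule cong) (simp add: edge_linearD[OF assms(1) u])
  also have "\<dots> = a * I (L v) + b * I (L w)"
    by (subst add) (auto intro!: continuous_intros assms(2) simp: scale)
  finally show "I (L u) = a *\<^sub>R I (L v) + b *\<^sub>R I (L w)" by simp
qed

context meshed
begin

text \<open>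
  The term with \<open>CF\<close> integrates to zero against the mean-free test polynomials. Parametrized by their
  gradients \<open>b\<close>, the test vectors are the quarter turns of \<open>b\<close>; solving for \<open>b\<close>
  turns the defining equation into a Riesz representation on the tangent plane.
\<close>

lemma edge_linear_gammat:
  assumes "F \<in> faces M"
  shows "edge_linear M (gammat M F)"
proof -
  interpret F: flat_cell F "intF M F" "tplane M F" "pnt M F" using assms by (rule face_cell)
  let ?n = "nrm M F" and ?H = "tplane M F"
  note n = unit_normal[OF assms]
  define \<Lambda> where "\<Lambda> v \<xi> = 1 / area M F * (\<Sum>e\<in>edgesF M F. omegaFE M F e *
      intE M e (\<lambda>y. v e * F.zero_mean (cross3 ?n \<xi>) y))" for v \<xi>
  have e: "cell_integral e (intE M e)" "e \<in> edges M" if "e \<in> edgesF M F" for e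
    using edge_cell edgesF_subset that by auto
  have lin: "linear (\<Lambda> v)" for v
  proof -
    have "linear (\<lambda>\<xi>. v e * F.zero_mean (cross3 ?n \<xi>) y)" for e y
      by (intro linear_mult linear_compose[OF _ F.linear_zero_mean, unfolded o_def]
          linear_cross3 linear_ident)
    then have "linear (\<lambda>\<xi>. intE M e (\<lambda>y. v e * F.zero_mean (cross3 ?n \<xi>) y))" if "e \<in> edgesF M F" for e
      by (intro cell_integral.linear_integral[OF e(1)[OF that]] continuous_intros F.continuous_zero_mean)
    then show ?thesis unfolding \<Lambda>_def by (intro linear_intros)
  qed
  have "edge_linear M (\<lambda>v. \<Lambda> v \<xi>)" for \<xi>
    unfolding \<Lambda>_def
    by (intro edge_linear_mult edge_linear_sum cell_integral.edge_linear_integral[OF e(1)]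
        edge_linear_value e(2) continuous_intros F.continuous_zero_mean)
  note edge_linear_represented[OF subspace_tplane lin this]
  moreover have "(\<forall>r\<in>P01F M F. \<forall>x\<in>F. g \<bullet> rotF M F r x =
       1 / area M F * intF M F (\<lambda>y. CF M v F * r y) +
       1 / area M F * (\<Sum>e\<in>edgesF M F. omegaFE M F e * intE M e (\<lambda>y. v e * r y)))
     \<longleftrightarrow> (\<forall>\<xi>\<in>?H. g \<bullet> \<xi> = \<Lambda> v \<xi>)" (is "?l \<longleftrightarrow> ?r") for g v
  proof -
    have rot: "rotF M F (F.zero_mean b) x = cross3 b ?n" if "b \<in> ?H" for b x
      using rotF_affine[OF that, of "- intF M F (\<lambda>y. b \<bullet> (y - pnt M F)) / intF M F (\<lambda>y. 1)"]
      by (simp add: F.zero_mean_def[abs_def])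
    have mean: "intF M F (F.zero_mean b) = 0" if "b \<in> ?H" for b
      using F.zero_mean_polynomials that by blast
    have "P01F M F = F.zero_mean ` ?H" unfolding P01F_def by (rule F.zero_mean_polynomials)
    then have "?l \<longleftrightarrow> (\<forall>b\<in>?H. g \<bullet> cross3 b ?n = 1 / area M F *
        (\<Sum>e\<in>edgesF M F. omegaFE M F e * intE M e (\<lambda>y. v e * F.zero_mean b y)))"
      using F.nonempty by (auto simp: rot mean F.scale)
    also have "\<dots> \<longleftrightarrow> ?r"
      unfolding \<Lambda>_def
    proof (intro iffI ballI)
      fix \<xi> assume *: "\<forall>b\<in>?H. g \<bullet> cross3 b ?n = 1 / area M F *
        (\<Sum>e\<in>edgesF M F. omegaFE M F e * intE M e (\<lambda>y. v e * F.zero_mean b y))" and "\<xi> \<in> ?H"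
      then show "g \<bullet> \<xi> = 1 / area M F * (\<Sum>e\<in>edgesF M F. omegaFE M F e *
          intE M e (\<lambda>y. v e * F.zero_mean (cross3 ?n \<xi>) y))"
        using *[rule_format, of "cross3 ?n \<xi>"] by (simp add: cross3_tplane[OF n] cross3_in_tplane)
    next
      fix b assume *: "\<forall>\<xi>\<in>?H. g \<bullet> \<xi> = 1 / area M F * (\<Sum>e\<in>edgesF M F. omegaFE M F e *
          intE M e (\<lambda>y. v e * F.zero_mean (cross3 ?n \<xi>) y))" and "b \<in> ?H"
      then show "g \<bullet> cross3 b ?n = 1 / area M F *
        (\<Sum>e\<in>edgesF M F. omegaFE M F e * intE M e (\<lambda>y. v e * F.zero_mean b y))"
        using *[rule_format, of "cross3 b ?n"] by (simp add: cross3_tplane[OF n] cross3_in_tplane)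
    qed
    finally show ?thesis .
  qed
  ultimately show ?thesis unfolding gammat_def[abs_def] by simp
qed

lemma edge_linear_CT:
  assumes "T \<in> elems M"
  shows "edge_linear M (CT M T)"
proof -
  define \<Lambda> where "\<Lambda> v \<xi> = 1 / vol T * (\<Sum>F\<in>facesT M T. omegaTF M T F * area M F *
      (gammat M F v \<bullet> cross3 \<xi> (nrm M F)))" for v \<xi>
  have lin: "linear (\<Lambda> v)" for v
    unfolding \<Lambda>_def
    by (intro linear_intros linear_ident)
  have "edge_linear M (\<lambda>v. \<Lambda> v \<xi>)" for \<xi>
    unfolding \<Lambda>_def
    by (intro edge_linear_mult edge_linear_sum edge_linear_inner edge_linear_gammat)
       (use facesT_subset in blast)
  from edge_linear_represented[OF subspace_UNIV lin this] show ?thesis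
    unfolding \<Lambda>_def CT_def[abs_def] by simp
qed

text \<open>
  The curl of \<open>x \<mapsto> (x - p) \<times> c\<close> is the constant \<open>- 2 c\<close>, so the test functions
  with \<open>c = - \<xi> / 2\<close> reach every vector \<open>\<xi>\<close>.
\<close>

lemma edge_linear_PcurlT:
  assumes "T \<in> elems M"
  shows "edge_linear M (PcurlT M T)"
proof -
  interpret T: flat_cell T "intT T" UNIV "pnt M T" using assms by (rule element_cell)
  define R where "R v w = 1 / vol T * intT T (\<lambda>y. CT M T v \<bullet> w y) -
       1 / vol T * (\<Sum>F\<in>facesT M T.
          omegaTF M T F * intF M F (\<lambda>y. gammat M F v \<bullet> cross3 (w y) (nrm M F)))" for v w
  define \<Lambda> where "\<Lambda> v \<xi> = R v (\<lambda>x. cross3 (x - pnt M T) (- (1 / 2) *\<^sub>R \<xi>))" for v \<xi>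
  have F: "F \<in> faces M" "cell_integral F (intF M F)" if "F \<in> facesT M T" for F
    using that facesT_subset face_cell by (auto simp: flat_cell_def)
  have lin: "linear (\<Lambda> v)" for v
  proof -
    have "linear (\<lambda>\<xi>. intF M F (\<lambda>y. gammat M F v \<bullet>
         cross3 (cross3 (y - pnt M T) (- (1 / 2) *\<^sub>R \<xi>)) (nrm M F)))" if "F \<in> facesT M T" for F
      by (intro cell_integral.linear_integral[OF F(2)[OF that]] linear_intros linear_ident
          continuous_intros continuous_on_cross)
    moreover have "linear (\<lambda>\<xi>. intT T (\<lambda>y. CT M T v \<bullet> cross3 (y - pnt M T) (- (1 / 2) *\<^sub>R \<xi>)))"
      by (intro T.linear_integral linear_intros linear_ident continuous_intros continuous_on_cross)
    ultimately show ?thesis unfolding \<Lambda>_def R_def by (intro linear_intros)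
  qed
  have "edge_linear M (\<lambda>v. \<Lambda> v \<xi>)" for \<xi>
    unfolding \<Lambda>_def R_def
    by (intro edge_linear_diff edge_linear_mult edge_linear_sum T.edge_linear_integral
        cell_integral.edge_linear_integral[OF F(2)] edge_linear_inner
        edge_linear_CT[OF assms] edge_linear_gammat F(1) continuous_intros continuous_on_cross)
  note edge_linear_represented[OF subspace_UNIV lin this]
  moreover have "(\<forall>w\<in>{\<lambda>x. cross3 (x - pnt M T) c | c. True}. \<forall>x\<in>T. g \<bullet> curl w x = R v w)
      \<longleftrightarrow> (\<forall>\<xi>. g \<bullet> \<xi> = \<Lambda> v \<xi>)" (is "?l \<longleftrightarrow> ?r") for g v
  proof -
    have "?l \<longleftrightarrow> (\<forall>c. g \<bullet> (- 2 *\<^sub>R c) = R v (\<lambda>x. cross3 (x - pnt M T) c))"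
    proof -
      have "?l \<longleftrightarrow> (\<forall>c. \<forall>x\<in>T. g \<bullet> curl (\<lambda>x. cross3 (x - pnt M T) c) x =
          R v (\<lambda>x. cross3 (x - pnt M T) c))" by blast
      then show ?thesis using T.nonempty by (simp add: curl_rotation ex_in_conv)
    qed
    also have "\<dots> \<longleftrightarrow> ?r"
    proof safe
      fix \<xi> assume "\<forall>c. g \<bullet> (- 2 *\<^sub>R c) = R v (\<lambda>x. cross3 (x - pnt M T) c)"
      from this[rule_format, of "- (1 / 2) *\<^sub>R \<xi>"] show "g \<bullet> \<xi> = \<Lambda> v \<xi>"
        unfolding \<Lambda>_def by simp
    next
      fix c assume "\<forall>\<xi>. g \<bullet> \<xi> = \<Lambda> v \<xi>"
      from this[rule_format, of "- 2 *\<^sub>R c"]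
      show "g \<bullet> (- 2 *\<^sub>R c) = R v (\<lambda>x. cross3 (x - pnt M T) c)"
        unfolding \<Lambda>_def by simp
    qed
    finally show ?thesis .
  qed
  ultimately show ?thesis unfolding PcurlT_def[abs_def] R_def[symmetric] by simp
qed

lemma edge_linear_ip_curl: "edge_linear M (\<lambda>v. ip_curl M v w)"
proof -
  have T: "edge_linear M (PcurlT M T)" if "T \<in> elems M" for T
    using that by (rule edge_linear_PcurlT)
  have t: "edge_linear M (gammat M F)" if "F \<in> facesT M T" for F T
    using that facesT_subset edge_linear_gammat by auto
  have v: "edge_linear M (\<lambda>v. v e)" if "e \<in> edgesT M T" for e T
    using that edgesT_subset edge_linear_value by auto
  have tproj: "linear (tproj M F)" for F
    unfolding tproj_def by (simp add: linear_iff cross_add_left cross_mult_left cross_add_right cross_mult_right)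
  have F: "cell_integral F (intF M F)" if "F \<in> facesT M T" for F T
    using that facesT_subset face_cell by (auto simp: flat_cell_def)
  have e: "cell_integral e (intE M e)" if "e \<in> edgesT M T" for e T
    using that edgesT_subset edge_cell by auto
  have T': "cell_integral T (intT T)" if "T \<in> elems M" for T
    using that element_cell by (auto simp: flat_cell_def)
  show ?thesis
    unfolding ip_curl_def s_curl_def
    by (intro edge_linear_sum edge_linear_add edge_linear_mult edge_linear_diff edge_linear_inner
        cell_integral.edge_linear_integral[OF F] cell_integral.edge_linear_integral[OF e]
        cell_integral.edge_linear_integral[OF T'] edge_linear_compose[OF tproj] T t v
        continuous_on_const)
qed

end

section \<open>Affine potentials of scalar functions\<close>

context meshed
begin

text \<open>
  Continuity of \<open>q\<close> on the edges makes the right-hand side of the variational problem linear in the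
  test polynomial, so the problem has exactly one solution, and that solution is affine.
\<close>

lemma gammaF_affine:
  assumes "F \<in> faces M" and q: "\<And>e. e \<in> edgesF M F \<Longrightarrow> continuous_on e q"
  shows "gammaF M F q \<in> P1 (tplane M F)"
proof -
  interpret F: flat_cell F "intF M F" "tplane M F" "pnt M F" using assms(1) by (rule face_cell)
  define f where "f z x = (fst z + snd z \<bullet> (x - pnt M F)) *\<^sub>R (x - pnt M F)"
    for z :: "real \<times> pt3" and x
  define R where "R v = - intF M F (\<lambda>x. GF M F q \<bullet> v x) +
          (\<Sum>e\<in>edgesF M F. omegaFE M F e * intE M e (\<lambda>x. q x * (v x \<bullet> nrmFE M F e)))" for v
  have e: "cell_integral e (intE M e)" if "e \<in> edgesF M F" for e
    using edge_cell edgesF_subset that by auto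
  have f: "linear (\<lambda>z. f z x)" for x
    unfolding f_def by (simp add: linear_iff inner_add_left algebra_simps)
  have cont: "continuous_on A (f z)" for A z unfolding f_def by (intro continuous_intros)
  have "linear (\<lambda>z. R (f z))"
  proof -
    have "linear (\<lambda>z. intE M e (\<lambda>x. q x * (f z x \<bullet> nrmFE M F e)))" if "e \<in> edgesF M F" for e
      by (intro cell_integral.linear_integral[OF e[OF that]] linear_intros f
          continuous_intros cont q that)
    moreover have "linear (\<lambda>z. intF M F (\<lambda>x. GF M F q \<bullet> f z x))"
      by (intro F.linear_integral linear_intros f continuous_intros cont)
    ultimately show ?thesis unfolding R_def by (intro linear_intros)
  qed
  from F.ex1_affine[OF _ _ this, of 2 3]
  have "\<exists>!\<gamma>. \<gamma> \<in> P1 (tplane M F) \<and> (\<forall>a. \<forall>b\<in>tplane M F.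
      intF M F (\<lambda>x. \<gamma> x * (2 * a + 3 * (b \<bullet> (x - pnt M F)))) = R (f (a, b)))" by simp
  moreover have "(\<forall>v \<in> {\<lambda>x. p x *\<^sub>R (x - pnt M F) | p. p \<in> P1 (tplane M F)}.
        intF M F (\<lambda>x. \<gamma> x * divF M F v x) = R v) \<longleftrightarrow> (\<forall>a. \<forall>b\<in>tplane M F.
      intF M F (\<lambda>x. \<gamma> x * (2 * a + 3 * (b \<bullet> (x - pnt M F)))) = R (f (a, b)))" for \<gamma>
  proof -
    have "{\<lambda>x. p x *\<^sub>R (x - pnt M F) | p. p \<in> P1 (tplane M F)} = {f (a, b) | a b. b \<in> tplane M F}"
      unfolding F.radial_fields by (auto simp: f_def[abs_def])
    moreover have "divF M F (f (a, b)) x = 2 * a + 3 * (b \<bullet> (x - pnt M F))"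
      if "b \<in> tplane M F" for a b x
      using divF_radial[OF unit_normal[OF assms(1)] that] by (simp add: f_def[abs_def])
    moreover have "(\<forall>v\<in>{f (a, b) | a b. b \<in> tplane M F}. intF M F (\<lambda>x. \<gamma> x * divF M F v x) = R v) \<longleftrightarrow>
      (\<forall>a. \<forall>b\<in>tplane M F. intF M F (\<lambda>x. \<gamma> x * divF M F (f (a, b)) x) = R (f (a, b)))" by blast
    ultimately show ?thesis by simp
  qed
  ultimately have "\<exists>!\<gamma>. \<gamma> \<in> P1 (tplane M F) \<and>
      (\<forall>v \<in> {\<lambda>x. p x *\<^sub>R (x - pnt M F) | p. p \<in> P1 (tplane M F)}.
        intF M F (\<lambda>x. \<gamma> x * divF M F v x) = R v)" by simp
  from theI'[OF this] show ?thesis unfolding gammaF_def R_def by blast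
qed

text \<open>
  The functional on the right-hand side integrates the face traces of \<open>q\<close>, and is linear in the
  test field because these traces are affine.
\<close>

lemma PgradT_affine:
  assumes "T \<in> elems M"
    and q: "\<And>F e. F \<in> facesT M T \<Longrightarrow> e \<in> edgesF M F \<Longrightarrow> continuous_on e q"
  shows "PgradT M T q \<in> P1 UNIV"
proof -
  interpret T: flat_cell T "intT T" UNIV "pnt M T" using assms(1) by (rule element_cell)
  define f where "f z x = (fst z + snd z \<bullet> (x - pnt M T)) *\<^sub>R (x - pnt M T)"
    for z :: "real \<times> pt3" and x
  define R where "R v = - intT T (\<lambda>x. GT M T q \<bullet> v x) +
          (\<Sum>F\<in>facesT M T.
             omegaTF M T F * intF M F (\<lambda>x. gammaF M F q x * (v x \<bullet> nrm M F)))" for v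
  have F: "cell_integral F (intF M F)" if "F \<in> facesT M T" for F
    using face_cell facesT_subset that by (auto simp: flat_cell_def)
  have \<gamma>: "continuous_on A (gammaF M F q)" if "F \<in> facesT M T" for A F
    by (rule P1_continuous, rule gammaF_affine) (use that facesT_subset q in auto)
  have f: "linear (\<lambda>z. f z x)" for x
    unfolding f_def by (simp add: linear_iff inner_add_left algebra_simps)
  have cont: "continuous_on A (f z)" for A z unfolding f_def by (intro continuous_intros)
  have "linear (\<lambda>z. R (f z))"
  proof -
    have "linear (\<lambda>z. intF M F (\<lambda>x. gammaF M F q x * (f z x \<bullet> nrm M F)))"
      if "F \<in> facesT M T" for F
      by (intro cell_integral.linear_integral[OF F[OF that]] linear_intros f
          continuous_intros cont \<gamma> that)
    moreover have "linear (\<lambda>z. intT T (\<lambda>x. GT M T q \<bullet> f z x))"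
      by (intro T.linear_integral linear_intros f continuous_intros cont)
    ultimately show ?thesis unfolding R_def by (intro linear_intros)
  qed
  from T.ex1_affine[OF _ _ this, of 3 4]
  have "\<exists>!\<rho>. \<rho> \<in> P1 UNIV \<and> (\<forall>a b.
      intT T (\<lambda>x. \<rho> x * (3 * a + 4 * (b \<bullet> (x - pnt M T)))) = R (f (a, b)))" by simp
  moreover have "(\<forall>v \<in> {\<lambda>x. p x *\<^sub>R (x - pnt M T) | p. p \<in> P1 UNIV}.
        intT T (\<lambda>x. \<rho> x * divergence v x) = R v) \<longleftrightarrow> (\<forall>a b.
      intT T (\<lambda>x. \<rho> x * (3 * a + 4 * (b \<bullet> (x - pnt M T)))) = R (f (a, b)))" for \<rho>
  proof -
    have "{\<lambda>x. p x *\<^sub>R (x - pnt M T) | p. p \<in> P1 UNIV} = {f (a, b) | a b. True}"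
      unfolding T.radial_fields by (auto simp: f_def[abs_def])
    moreover have "divergence (f (a, b)) x = 3 * a + 4 * (b \<bullet> (x - pnt M T))" for a b x
      using divergence_radial[of a b "pnt M T"] by (simp add: f_def[abs_def])
    moreover have "(\<forall>v\<in>{f (a, b) | a b. True}. intT T (\<lambda>x. \<rho> x * divergence v x) = R v) \<longleftrightarrow>
      (\<forall>a b. intT T (\<lambda>x. \<rho> x * divergence (f (a, b)) x) = R (f (a, b)))" by blast
    ultimately show ?thesis by simp
  qed
  ultimately have "\<exists>!\<rho>. \<rho> \<in> P1 UNIV \<and>
      (\<forall>v \<in> {\<lambda>x. p x *\<^sub>R (x - pnt M T) | p. p \<in> P1 UNIV}.
        intT T (\<lambda>x. \<rho> x * divergence v x) = R v)" by simp
  from theI'[OF this] show ?thesis unfolding PgradT_def R_def by blast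
qed

end

section \<open>Algebra-valued potentials and the bracket term\<close>

locale meshed_algebra = meshed M for M :: mesh +
  fixes Bs :: "'g :: real_inner set" and br :: "'g \<Rightarrow> 'g \<Rightarrow> 'g"
  assumes lie: "invariant_lie_algebra br"
    and basis: "finite Bs" "independent Bs" "span Bs = UNIV"
begin

lemma coef_combination:
  assumes "u p = a *\<^sub>R v p + b *\<^sub>R w p"
  shows "coef Bs u c p = a * coef Bs v c p + b * coef Bs w c p"
  unfolding coef_def assms
  by (simp add: representation_add[OF basis(2)] representation_scale[OF basis(2)] basis(3))

lemma lift3_combination:
  assumes P: "edge_linear M P" and u: "\<And>e. e \<in> edges M \<Longrightarrow> u e = a *\<^sub>R v e + b *\<^sub>R w e"
  shows "lift3 Bs P u = a *\<^sub>R lift3 Bs P v + b *\<^sub>R lift3 Bs P w"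
proof -
  have "P (coef Bs u c) = a *\<^sub>R P (coef Bs v c) + b *\<^sub>R P (coef Bs w c)" for c
    by (rule edge_linearD[OF P]) (rule coef_combination, erule u)
  then show ?thesis
    by (simp add: lift3_def vec_eq_iff scaleR_add_left sum.distrib scaleR_sum_right)
qed

lemma ip_curl_combination:
  assumes u: "\<And>e. e \<in> edges M \<Longrightarrow> u e = a *\<^sub>R v e + b *\<^sub>R w e"
  shows "ip_g Bs (ip_curl M) u z = a * ip_g Bs (ip_curl M) v z + b * ip_g Bs (ip_curl M) w z"
proof -
  have "ip_curl M (coef Bs u c) y = a *\<^sub>R ip_curl M (coef Bs v c) y + b *\<^sub>R ip_curl M (coef Bs w c) y" for c y
    by (rule edge_linearD[OF edge_linear_ip_curl]) (rule coef_combination, erule u)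
  then show ?thesis
    by (simp add: ip_g_def distrib_right sum.distrib sum_distrib_left mult.assoc)
qed

lemma Pcurlh_combination:
  assumes u: "\<And>e. e \<in> edges M \<Longrightarrow> u e = a *\<^sub>R v e + b *\<^sub>R w e"
  shows "Pcurlh M Bs u x = a *\<^sub>R Pcurlh M Bs v x + b *\<^sub>R Pcurlh M Bs w x"
  by (simp add: Pcurlh_def lift3_combination[OF edge_linear_PcurlT u] sum.distrib scaleR_sum_right)

lemma vbr_linear:
  "linear (\<lambda>v. v \<bullet> vbr br w c)" "linear (\<lambda>w. v \<bullet> vbr br w c)" "linear (\<lambda>c. v \<bullet> vbr br w c)"
proof -
  have br: "linear (br a)" "linear (\<lambda>x. br x a)" for a
    using lie by (auto simp: invariant_lie_algebra_def bilinear_def)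
  show "linear (\<lambda>v. v \<bullet> vbr br w c)" "linear (\<lambda>w. v \<bullet> vbr br w c)" "linear (\<lambda>c. v \<bullet> vbr br w c)"
    by (auto simp: linear_iff inner_vec_def vbr_def inner_add_left inner_add_right sum.distrib
        sum_distrib_left linear_add[OF br(1)] linear_scale[OF br(1)]
        linear_add[OF br(2)] linear_scale[OF br(2)])
qed

text \<open>The cancellation behind the conservation law: invariance moves the bracket onto equal arguments.\<close>

lemma vbr_self: "v \<bullet> vbr br v c = 0"
proof -
  have "br a a = 0" "br a b \<bullet> c = a \<bullet> br b c" for a b c
    using lie by (auto simp: invariant_lie_algebra_def)
  then have "a \<bullet> br a c = 0" for a by (metis inner_zero_left)
  then show ?thesis by (simp add: inner_vec_def vbr_def)
qed

lemma continuous_coef: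
  assumes q: "q \<in> Xgrad M" and e: "e \<in> edges M"
  shows "continuous_on e (coef Bs q c)"
proof -
  obtain a b where ab: "\<And>x. x \<in> e \<Longrightarrow> q x = a + ((x - pnt M e) \<bullet> tang M e) *\<^sub>R b"
    using q e unfolding Xgrad_def by blast
  have "coef Bs q c x = representation Bs a c + ((x - pnt M e) \<bullet> tang M e) * representation Bs b c"
    if "x \<in> e" for x
    by (simp add: coef_def ab[OF that] representation_add[OF basis(2)]
        representation_scale[OF basis(2)] basis(3))
  then show ?thesis
    by (subst continuous_on_cong[OF refl]) (auto intro!: continuous_intros)
qed

text \<open>
  The curl potentials are piecewise constant and the gradient potential is piecewise affine, so
  the integrand is a finite sum of affine functions cut off to bounded open sets.
\<close>

lemma integrable_bracket:
  assumes q: "q \<in> Xgrad M"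
  shows "set_integrable lborel (region M)
    (\<lambda>x. Pcurlh M Bs v x \<bullet> vbr br (Pcurlh M Bs w x) (Pgradh M Bs q x))"
proof -
  let ?\<rho> = "\<lambda>T c. PgradT M T (coef Bs q c)"
  let ?V = "\<lambda>v T. lift3 Bs (PcurlT M T) v"
  let ?J = "\<lambda>x. {T \<in> elems M. x \<in> interior T}"
  let ?X = "\<lambda>T T' T''. interior T \<inter> interior T' \<inter> interior T''"
  have fin: "finite (elems M)" by (rule finite_elems)
  have U: "open (region M)" "bounded (region M)"
    using mesh by (auto simp: polyhedral_mesh_def polyhedral_domain_def)
  have expand: "Pcurlh M Bs v x \<bullet> vbr br (Pcurlh M Bs w x) (Pgradh M Bs q x) =
    (\<Sum>T\<in>elems M. \<Sum>T'\<in>elems M. \<Sum>T''\<in>elems M. \<Sum>c\<in>Bs.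
       indicator (?X T T' T'') x * (?\<rho> T'' c x * (?V v T \<bullet> vbr br (?V w T') c)))" for x
  proof -
    have "Pcurlh M Bs v x \<bullet> vbr br (Pcurlh M Bs w x) (Pgradh M Bs q x) =
      (\<Sum>T\<in>?J x. \<Sum>T'\<in>?J x. \<Sum>T''\<in>?J x. \<Sum>c\<in>Bs. ?\<rho> T'' c x * (?V v T \<bullet> vbr br (?V w T') c))"
      unfolding Pcurlh_def Pgradh_def lift_def linear_sum[OF vbr_linear(1)]
      unfolding linear_sum[OF vbr_linear(2)]
      unfolding linear_sum[OF vbr_linear(3)] linear_scale[OF vbr_linear(3)] by simp
    also have "\<dots> = (\<Sum>T\<in>elems M. \<Sum>T'\<in>elems M. \<Sum>T''\<in>elems M. \<Sum>c\<in>Bs.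
       indicator (?X T T' T'') x * (?\<rho> T'' c x * (?V v T \<bullet> vbr br (?V w T') c)))"
      using fin
      by (auto simp: sum.inter_filter indicator_def intro!: sum.cong)
    finally show ?thesis .
  qed
  have summand: "integrable lborel (\<lambda>x. indicator (region M) x *\<^sub>R
      (indicator (?X T T' T'') x * (?\<rho> T'' c x * d)))" if T: "T'' \<in> elems M" for T T' T'' c and d :: real
  proof -
    have "?\<rho> T'' c \<in> P1 UNIV"
      by (rule PgradT_affine[OF T]) (use continuous_coef[OF q] edgesF_subset in auto)
    then have "integrable lborel (\<lambda>x. indicator (closure (region M)) x *\<^sub>R (?\<rho> T'' c x * d))"
      using U by (intro borel_integrable_compact continuous_intros P1_continuous) auto
    then have "integrable lborel (\<lambda>x. indicator (region M \<inter> ?X T T' T'') x *\<^sub>R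
        (indicator (closure (region M)) x *\<^sub>R (?\<rho> T'' c x * d)))"
      by (rule integrable_mult_indicator[rotated]) (use U(1) in auto)
    moreover have "(\<lambda>x. indicator (region M \<inter> ?X T T' T'') x *\<^sub>R
        (indicator (closure (region M)) x *\<^sub>R (?\<rho> T'' c x * d))) =
      (\<lambda>x. indicator (region M) x *\<^sub>R (indicator (?X T T' T'') x * (?\<rho> T'' c x * d)))"
      using closure_subset[of "region M"] by (auto simp: indicator_def fun_eq_iff)
    ultimately show ?thesis by simp
  qed
  show ?thesis
    unfolding set_integrable_def expand scaleR_sum_right
    by (intro Bochner_Integration.integrable_sum summand)
qed

end

section \<open>Conservation of the constraint\<close>

theorem proposition7:
  fixes M :: mesh
    and Bs :: "'g :: real_inner set"
    and br :: "'g \<Rightarrow> 'g \<Rightarrow> 'g"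
    and \<theta> :: real
    and N :: nat
    and t :: "nat \<Rightarrow> real"
    and A E :: "nat \<Rightarrow> pt3 set \<Rightarrow> 'g"
    and lam :: "nat \<Rightarrow> pt3 \<Rightarrow> 'g"
  assumes "polyhedral_mesh M"
    and "invariant_lie_algebra br"
    and "finite Bs" and "independent Bs" and "span Bs = UNIV"
    and "1 / 2 \<le> \<theta>" and "\<theta> \<le> 1"
    and "t 0 = 0" and "\<And>n. n < N \<Longrightarrow> t n < t (Suc n)"
    and "\<And>n. n \<le> N \<Longrightarrow> lam n \<in> Xgrad M"
    and "\<And>n e. n < N \<Longrightarrow> e \<in> edges M \<Longrightarrow> delta_t t A n e = - interp \<theta> E n e"
    and "\<And>n (v :: pt3 set \<Rightarrow> 'g). n < N \<Longrightarrow>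
      ip_g Bs (ip_curl M) (delta_t t E n) v
      + ip_g Bs (ip_curl M) (lift Bs (Gh M) (lam (Suc n))) v
      + (LINT x:region M|lborel.
           vbr br (Pcurlh M Bs (interp \<theta> A n) x) (Pgradh M Bs (lam (Suc n)) x)
             \<bullet> Pcurlh M Bs v x)
      = ip_g Bs (ip_div M) (interp \<theta> (\<lambda>m. magnetic M Bs br (A m)) n)
          (\<lambda>F. lift Bs (CF M) v F + bracket_div M Bs br (interp (1 / 2) A n) v F)"
    and "\<And>n q. n < N \<Longrightarrow> q \<in> Xgrad M \<Longrightarrow>
      ip_g Bs (ip_curl M) (delta_t t E n) (lift Bs (Gh M) q)
      + (LINT x:region M|lborel.
           Pcurlh M Bs (delta_t t E n) x
             \<bullet> vbr br (Pcurlh M Bs (interp (1 - \<theta>) A n) x) (Pgradh M Bs q x))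
      = 0"
  shows "\<forall>q\<in>Xgrad M. \<forall>m\<le>N. \<forall>n\<le>N.
    constraint M Bs br (A m) (E m) q = constraint M Bs br (A n) (E n) q"
proof (intro ballI allI impI)
  interpret meshed_algebra M Bs br
    using assms(1-5) by unfold_locales
  fix q :: "pt3 \<Rightarrow> 'g" and m n assume q: "q \<in> Xgrad M" and m: "m \<le> N" and n: "n \<le> N"
  let ?P = "Pcurlh M Bs" and ?G = "lift Bs (Gh M) q"
  let ?ip = "ip_g Bs (ip_curl M)"
  have step: "constraint M Bs br (A (Suc k)) (E (Suc k)) q = constraint M Bs br (A k) (E k) q"
    if k: "k < N" for k
  proof -
    define d where "d = t (Suc k) - t k"
    have d: "d > 0" using assms(9)[OF k] by (simp add: d_def)
    define \<tau> where "\<tau> v w x = v \<bullet> vbr br w (Pgradh M Bs q x)" for v w x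
    have \<tau>: "\<tau> (a *\<^sub>R v + b *\<^sub>R v') w x = a * \<tau> v w x + b * \<tau> v' w x"
      "\<tau> v (a *\<^sub>R w + b *\<^sub>R w') x = a * \<tau> v w x + b * \<tau> v w' x" for a b v v' w w' x
      unfolding \<tau>_def
      using vbr_linear(1)[of w "Pgradh M Bs q x"] vbr_linear(2)[of v "Pgradh M Bs q x"]
      by (auto simp: linear_iff)
    have \<tau>_self: "\<tau> v v x = 0" for v x unfolding \<tau>_def by (rule vbr_self)
    let ?dE = "delta_t t E k" and ?E\<theta> = "interp \<theta> E k" and ?A\<theta> = "interp (1 - \<theta>) A k"
    have dE: "?dE e = (1 / d) *\<^sub>R E (Suc k) e + (- (1 / d)) *\<^sub>R E k e" for e
      by (simp add: delta_t_def d_def scaleR_diff_right inverse_eq_divide)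
    have E\<theta>: "?E\<theta> e = \<theta> *\<^sub>R E (Suc k) e + (1 - \<theta>) *\<^sub>R E k e" for e
      by (simp add: interp_def)
    have A\<theta>: "?A\<theta> e = (1 - \<theta>) *\<^sub>R A (Suc k) e + \<theta> *\<^sub>R A k e" for e
      by (simp add: interp_def)
    \<comment> \<open>The first equation of the scheme, solved for the new potential.\<close>
    have A_Suc: "A (Suc k) e = 1 *\<^sub>R A k e + (- d) *\<^sub>R ?E\<theta> e" if e: "e \<in> edges M" for e
    proof -
      have "d *\<^sub>R delta_t t A k e = A (Suc k) e - A k e"
        using d by (simp add: delta_t_def d_def[symmetric])
      then show ?thesis using assms(11)[OF k e] by (simp add: algebra_simps)
    qed
    have \<tau>_dE: "d * \<tau> (?P ?dE x) w x = \<tau> (?P (E (Suc k)) x) w x - \<tau> (?P (E k) x) w x" for w x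
      unfolding Pcurlh_combination[OF dE] \<tau>(1) using d by (simp add: right_diff_distrib')
    have product_rule: "a - a' = (1 - \<theta>) * (a - b) + \<theta> * (b' - a')"
      if "\<theta> * a + (1 - \<theta>) * b = \<theta> * b' + (1 - \<theta>) * a'" for a a' b b' :: real
      using that by (simp add: algebra_simps)
    have pointwise: "\<tau> (?P (E (Suc k)) x) (?P (A (Suc k)) x) x - \<tau> (?P (E k) x) (?P (A k) x) x
        = d * \<tau> (?P ?dE x) (?P ?A\<theta> x) x" for x
    proof -
      let ?V1 = "?P (E (Suc k)) x" and ?V0 = "?P (E k) x"
        and ?W1 = "?P (A (Suc k)) x" and ?W0 = "?P (A k) x"
      have "\<tau> (?P ?E\<theta> x) ?W1 x = \<tau> (?P ?E\<theta> x) ?W0 x"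
        by (simp add: Pcurlh_combination[OF A_Suc] \<tau>(2)[of _ 1 _ "- d", simplified] \<tau>_self)
      \<comment> \<open>The second term of the discrete product rule is zero:\<close>
      then have "\<theta> * \<tau> ?V1 ?W1 x + (1 - \<theta>) * \<tau> ?V0 ?W1 x
          = \<theta> * \<tau> ?V1 ?W0 x + (1 - \<theta>) * \<tau> ?V0 ?W0 x"
        unfolding Pcurlh_combination[OF E\<theta>] \<tau>(1) .
      then have "\<tau> ?V1 ?W1 x - \<tau> ?V0 ?W0 x
          = (1 - \<theta>) * (\<tau> ?V1 ?W1 x - \<tau> ?V0 ?W1 x) + \<theta> * (\<tau> ?V1 ?W0 x - \<tau> ?V0 ?W0 x)"
        by (rule product_rule)
      also have "\<dots> = (1 - \<theta>) * (d * \<tau> (?P ?dE x) ?W1 x) + \<theta> * (d * \<tau> (?P ?dE x) ?W0 x)"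
        unfolding \<tau>_dE ..
      also have "\<dots> = d * \<tau> (?P ?dE x) (?P ?A\<theta> x) x"
        unfolding Pcurlh_combination[OF A\<theta>] \<tau>(2) by (simp only: distrib_left mult.left_commute)
      finally show ?thesis .
    qed
    have int: "set_integrable lborel (region M) (\<lambda>x. \<tau> (?P v x) (?P w x) x)" for v w
      unfolding \<tau>_def by (rule integrable_bracket[OF q])
    have "(LINT x:region M|lborel. \<tau> (?P (E (Suc k)) x) (?P (A (Suc k)) x) x)
        - (LINT x:region M|lborel. \<tau> (?P (E k) x) (?P (A k) x) x)
      = (LINT x:region M|lborel. d * \<tau> (?P ?dE x) (?P ?A\<theta> x) x)"
      by (simp add: set_integral_diff(2)[OF int int, symmetric] pointwise)
    also have "\<dots> = d * (LINT x:region M|lborel. \<tau> (?P ?dE x) (?P ?A\<theta> x) x)" by simp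
    also have "\<dots> = - (d * ?ip ?dE ?G)"
      using assms(13)[OF k q] unfolding \<tau>_def by (simp add: eq_neg_iff_add_eq_0 flip: distrib_left)
    also have "\<dots> = ?ip (E k) ?G - ?ip (E (Suc k)) ?G"
      unfolding ip_curl_combination[OF dE] using d by (simp add: field_simps)
    finally show ?thesis unfolding constraint_def \<tau>_def by simp
  qed
  have initial: "constraint M Bs br (A k) (E k) q = constraint M Bs br (A 0) (E 0) q" if "k \<le> N" for k
    using that by (induction k) (simp_all add: step)
  show "constraint M Bs br (A m) (E m) q = constraint M Bs br (A n) (E n) q"
    unfolding initial[OF m] initial[OF n] ..
qed

end
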